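(* Let $J,P\ge1$ be integers, $h=1/(J+1)$, $\tau>0$ the time step, $t_n=n\tau$, $\alpha>0$, $\epsilon\ge0$, $\lambda=\pm1$, and let $\{\Psi^n\}_{n\ge1}\subset\mathbb{C}^J$ be the solution of the fully discrete scheme $$\Psi^{n+1}-e^{f(\Psi^n)}\Psi^n=\mathbf{i}\frac{\tau}{2h^2}A\left(\Psi^{n+1}+e^{f(\Psi^n)}\Psi^n\right)-\frac14\alpha\tau\left(\Psi^{n+1}+e^{f(\Psi^n)}\Psi^n\right)+\epsilon\,\sigma\Lambda\,\delta_{n+1}\beta,$$ with $\Psi^0=(\psi_0(x_1),\dots,\psi_0(x_J))^T$ and $f(\Psi^n)=\left(-\frac12\alpha I+\mathbf{i}\lambda F(\Psi^n)\right)\tau$. Assume that $\mathbb{E}\|\psi_0\|_{L^2}^2<\infty$, that $Q$ is a Hilbert–Schmidt operator from $L^2$ to $\dot H^2$, and that $P\le C_*(J+1)$ for some constant $C_*\ge1$. Then $\{\Psi^n\}_{n\ge1}$ is uniformly bounded, i.e. $$h\,\mathbb{E}\|\Psi^n\|^2\le e^{-\alpha t_n}\,h\,\mathbb{E}\|\Psi^0\|^2+C,$$ with a constant $C$ depending on $\alpha,\epsilon,Q$ and $C_*$.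
   Context: $A\in\mathbb{R}^{J\times J}$ is the tridiagonal matrix with $-2$ on the diagonal and $1$ on the adjacent off-diagonals; $F(\Psi)=\mathrm{diag}\{|\psi_1|^2,\dots,|\psi_J|^2\}$ for $\Psi=(\psi_1,\dots,\psi_J)^T$; $x_j=jh$; $e_k(x)=\sqrt2\sin(k\pi x)$; $\sigma\in\mathbb{R}^{J\times P}$ has entries $\sigma_{jk}=e_k(x_j)$. $Q$ is a linear positive operator on $L^2=L^2(0,1)$ with $Qe_k=\sqrt{\eta_k}\,e_k$, $k\ge1$, and $\Lambda=\mathrm{diag}\{\sqrt{\eta_1},\dots,\sqrt{\eta_P}\}$. $\dot H^2=D(\Delta)$ is the domain of the Dirichlet Laplacian on $(0,1)$ with norm $\|\Delta u\|_{L^2}$; $Q$ being Hilbert–Schmidt from $L^2$ to $\dot H^2$ means $\sum_{k\ge1}\|Qe_k\|_{\dot H^2}^2=\sum_{k\ge1}(k\pi)^4\eta_k<\infty$. $\beta=(\beta_1,\dots,\beta_P)^T$, $\beta_k=\beta_k^1+\mathbf{i}\beta_k^2$, with $\{\beta_k^i\}$ independent standard real Brownian motions with respect to a filtration $\{\mathcal F_t\}$, and $\delta_{n+1}\beta=\beta(t_{n+1})-\beta(t_n)$. $\|\cdot\|$ is the Euclidean norm on $\mathbb{C}^J$. The initial function $\psi_0$ may be random and is $\mathcal F_0$-measurable, with meaningful point values. *)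

theory Defs
  imports "HOL-Probability.Probability" "Jordan_Normal_Form.Matrix"
begin

unbundle no vec_syntax

section \<open>The space L2(0,1) and the Dirichlet Laplacian\<close>

text \<open>Elements of the complex space \<open>L\<^sup>2(0,1)\<close> are represented by square integrable functions;
  equality in \<open>L\<^sup>2\<close> is equality almost everywhere on \<open>(0,1)\<close>, and operators on \<open>L\<^sup>2\<close> are maps on
  representatives that respect it.\<close>

abbreviation unit_measure :: "real measure" where
  "unit_measure \<equiv> restrict_space lborel {0<..<1}"

definition in_L2 :: "(real \<Rightarrow> complex) \<Rightarrow> bool" where
  "in_L2 u \<longleftrightarrow> u \<in> borel_measurable unit_measure \<and> integrable unit_measure (\<lambda>x. (cmod (u x))\<^sup>2)"

definition L2_inner :: "(real \<Rightarrow> complex) \<Rightarrow> (real \<Rightarrow> complex) \<Rightarrow> complex" where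
  "L2_inner u v = (LINT x|unit_measure. u x * cnj (v x))"

definition L2_norm :: "(real \<Rightarrow> complex) \<Rightarrow> real" where
  "L2_norm u = sqrt (LINT x|unit_measure. (cmod (u x))\<^sup>2)"

definition sine_basis :: "nat \<Rightarrow> real \<Rightarrow> complex" where
  "sine_basis k x = complex_of_real (sqrt 2 * sin (real k * pi * x))"

text \<open>\<open>dirichlet_laplacian u g\<close> means \<open>u \<in> D(\<Delta>)\<close> and \<open>\<Delta>u = g\<close>, where \<open>D(\<Delta>)\<close> is the intersection of
  \<open>H\<^sup>2(0,1)\<close> and \<open>H\<^sup>1\<^sub>0(0,1)\<close>: \<open>u\<close> has a representative \<open>v\<close> that is continuously differentiable on \<open>[0,1]\<close>
  and vanishes at both end points, and whose derivative \<open>w\<close> is absolutely continuous with weak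
  derivative \<open>g\<close>. The function \<open>g\<close> is determined by \<open>u\<close> up to a null set.\<close>

definition dirichlet_laplacian :: "(real \<Rightarrow> complex) \<Rightarrow> (real \<Rightarrow> complex) \<Rightarrow> bool" where
  "dirichlet_laplacian u g \<longleftrightarrow> in_L2 u \<and> in_L2 g \<and>
     (\<exists>v w. (AE x in unit_measure. u x = v x) \<and> v 0 = 0 \<and> v 1 = 0 \<and>
        (\<forall>x\<in>{0..1}. (v has_vector_derivative w x) (at x within {0..1})) \<and>
        (\<forall>x\<in>{0..1}. w x = w 0 + (LINT y:{0<..<x}|lborel. g y)))"

definition in_Hdot2 :: "(real \<Rightarrow> complex) \<Rightarrow> bool" where
  "in_Hdot2 u \<longleftrightarrow> (\<exists>g. dirichlet_laplacian u g)"

definition Hdot2_norm :: "(real \<Rightarrow> complex) \<Rightarrow> real" where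
  "Hdot2_norm u = L2_norm (SOME g. dirichlet_laplacian u g)"

definition positive_L2_operator :: "((real \<Rightarrow> complex) \<Rightarrow> (real \<Rightarrow> complex)) \<Rightarrow> bool" where
  "positive_L2_operator Q \<longleftrightarrow>
     (\<forall>u. in_L2 u \<longrightarrow> in_L2 (Q u)) \<and>
     (\<forall>u v. in_L2 u \<longrightarrow> in_L2 v \<longrightarrow> (AE x in unit_measure. u x = v x) \<longrightarrow>
        (AE x in unit_measure. Q u x = Q v x)) \<and>
     (\<forall>u v a b. in_L2 u \<longrightarrow> in_L2 v \<longrightarrow>
        (AE x in unit_measure. Q (\<lambda>y. a * u y + b * v y) x = a * Q u x + b * Q v x)) \<and>
     (\<forall>u. in_L2 u \<longrightarrow> Im (L2_inner (Q u) u) = 0 \<and> 0 \<le> Re (L2_inner (Q u) u))"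

text \<open>The Hilbert-Schmidt norm is computed in the orthonormal basis \<open>e\<^sub>1, e\<^sub>2, \<dots>\<close>; the series is
  indexed from 0, whence the successor.\<close>

definition hilbert_schmidt_L2_Hdot2 :: "((real \<Rightarrow> complex) \<Rightarrow> (real \<Rightarrow> complex)) \<Rightarrow> bool" where
  "hilbert_schmidt_L2_Hdot2 Q \<longleftrightarrow>
     (\<forall>u. in_L2 u \<longrightarrow> in_Hdot2 (Q u)) \<and>
     summable (\<lambda>k. (Hdot2_norm (Q (sine_basis (Suc k))))\<^sup>2)"

section \<open>Brownian motion with respect to a filtration\<close>

text \<open>The index type of the filtration is \<open>real\<close>, but only the times \<open>t \<ge> 0\<close> play a role; a filtration
  on \<open>[0,\<infinity>)\<close> is extended by \<open>F t = F 0\<close> for \<open>t < 0\<close>.\<close>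

definition filtered_prob_space :: "'w measure \<Rightarrow> (real \<Rightarrow> 'w measure) \<Rightarrow> bool" where
  "filtered_prob_space M F \<longleftrightarrow>
     prob_space M \<and> filtration (space M) F \<and> (\<forall>t\<ge>0. subalgebra M (F t))"

definition standard_brownian_motion ::
    "'w measure \<Rightarrow> (real \<Rightarrow> 'w measure) \<Rightarrow> (real \<Rightarrow> 'w \<Rightarrow> real) \<Rightarrow> bool" where
  "standard_brownian_motion M F B \<longleftrightarrow>
     (\<forall>t\<ge>0. B t \<in> borel_measurable (F t)) \<and>
     (AE \<omega> in M. B 0 \<omega> = 0) \<and>
     (AE \<omega> in M. continuous_on {0..} (\<lambda>t. B t \<omega>)) \<and>
     (\<forall>s t. 0 \<le> s \<and> s < t \<longrightarrow>
        distributed M lborel (\<lambda>\<omega>. B t \<omega> - B s \<omega>) (normal_density 0 (sqrt (t - s))) \<and>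
        prob_space.indep_set M (sets (F s))
          (sets (vimage_algebra (space M) (\<lambda>\<omega>. B t \<omega> - B s \<omega>) borel)))"

text \<open>Mutual independence of the processes is independence of their paths as random elements of the
  product space of all real functions on \<open>[0,\<infinity>)\<close>.\<close>

definition independent_brownian_motions ::
    "'w measure \<Rightarrow> (real \<Rightarrow> 'w measure) \<Rightarrow> 'i set \<Rightarrow> ('i \<Rightarrow> real \<Rightarrow> 'w \<Rightarrow> real) \<Rightarrow> bool" where
  "independent_brownian_motions M F I B \<longleftrightarrow>
     (\<forall>i\<in>I. standard_brownian_motion M F (B i)) \<and>
     prob_space.indep_vars M (\<lambda>_. Pi\<^sub>M {0..} (\<lambda>_. borel)) (\<lambda>i \<omega>. \<lambda>t\<in>{0..}. B i t \<omega>) I"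

section \<open>The fully discrete scheme\<close>

text \<open>Vector and matrix entries are indexed from 0, so that entry \<open>j\<close> of a vector of length \<open>J\<close> belongs to
  the grid point \<open>x\<^bsub>j+1\<^esub>\<close>, and column \<open>k\<close> of \<open>\<sigma>\<close> to the basis function \<open>e\<^bsub>k+1\<^esub>\<close>.\<close>

definition mesh :: "nat \<Rightarrow> real" where
  "mesh J = 1 / (real J + 1)"

definition grid_point :: "nat \<Rightarrow> nat \<Rightarrow> real" where
  "grid_point J j = real j * mesh J"

definition laplacian_mat :: "nat \<Rightarrow> complex mat" where
  "laplacian_mat J = Matrix.mat J J
     (\<lambda>(i, j). if i = j then -2 else if i = Suc j \<or> j = Suc i then 1 else 0)"

definition F_mat :: "nat \<Rightarrow> complex vec \<Rightarrow> complex mat" where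
  "F_mat J u = mat_diag J (\<lambda>j. complex_of_real ((cmod (u $ j))\<^sup>2))"

definition sigma_mat :: "nat \<Rightarrow> nat \<Rightarrow> complex mat" where
  "sigma_mat J P = Matrix.mat J P (\<lambda>(j, k). sine_basis (Suc k) (grid_point J (Suc j)))"

definition Lambda_mat :: "nat \<Rightarrow> (nat \<Rightarrow> real) \<Rightarrow> complex mat" where
  "Lambda_mat P \<eta> = mat_diag P (\<lambda>k. complex_of_real (sqrt (\<eta> (Suc k))))"

definition mat_exp :: "nat \<Rightarrow> complex mat \<Rightarrow> complex mat" where
  "mat_exp n X = Matrix.mat n n (\<lambda>(i, j). \<Sum>m. (X ^\<^sub>m m) $$ (i, j) / fact m)"

definition f_mat :: "nat \<Rightarrow> real \<Rightarrow> real \<Rightarrow> real \<Rightarrow> complex vec \<Rightarrow> complex mat" where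
  "f_mat J \<alpha> lam \<tau> u =
     complex_of_real \<tau> \<cdot>\<^sub>m
       (complex_of_real (- \<alpha> / 2) \<cdot>\<^sub>m 1\<^sub>m J + (\<i> * complex_of_real lam) \<cdot>\<^sub>m F_mat J u)"

definition sq_norm :: "complex vec \<Rightarrow> real" where
  "sq_norm v = (\<Sum>j<dim_vec v. (cmod (v $ j))\<^sup>2)"

text \<open>One step of the scheme, from \<open>u = \<Psi>\<^sup>n\<close> to \<open>u' = \<Psi>\<^bsup>n+1\<^esup>\<close> with noise increment \<open>d = \<delta>\<^bsub>n+1\<^esub>\<beta>\<close>.\<close>

definition scheme_step ::
    "nat \<Rightarrow> nat \<Rightarrow> real \<Rightarrow> real \<Rightarrow> real \<Rightarrow> real \<Rightarrow> (nat \<Rightarrow> real) \<Rightarrow>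
     complex vec \<Rightarrow> complex vec \<Rightarrow> complex vec \<Rightarrow> bool" where
  "scheme_step J P \<tau> \<alpha> \<epsilon> lam \<eta> d u u' \<longleftrightarrow>
     (let w = mat_exp J (f_mat J \<alpha> lam \<tau> u) *\<^sub>v u in
      u' - w =
        (\<i> * complex_of_real (\<tau> / (2 * (mesh J)\<^sup>2))) \<cdot>\<^sub>v (laplacian_mat J *\<^sub>v (u' + w))
        - complex_of_real (\<alpha> * \<tau> / 4) \<cdot>\<^sub>v (u' + w)
        + complex_of_real \<epsilon> \<cdot>\<^sub>v ((sigma_mat J P * Lambda_mat P \<eta>) *\<^sub>v d))"

text \<open>The real Brownian motions are indexed by \<open>(k, i)\<close> with \<open>1 \<le> k \<le> P\<close> and \<open>i \<in> {1, 2}\<close>.\<close>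

definition noise_increment ::
    "nat \<Rightarrow> real \<Rightarrow> (nat \<times> nat \<Rightarrow> real \<Rightarrow> 'w \<Rightarrow> real) \<Rightarrow> nat \<Rightarrow> 'w \<Rightarrow> complex vec" where
  "noise_increment P \<tau> B n \<omega> = Matrix.vec P (\<lambda>k.
     Complex (B (Suc k, 1) (real (Suc n) * \<tau>) \<omega>) (B (Suc k, 2) (real (Suc n) * \<tau>) \<omega>)
     - Complex (B (Suc k, 1) (real n * \<tau>) \<omega>) (B (Suc k, 2) (real n * \<tau>) \<omega>))"

definition scheme_solution ::
    "'w measure \<Rightarrow> nat \<Rightarrow> nat \<Rightarrow> real \<Rightarrow> real \<Rightarrow> real \<Rightarrow> real \<Rightarrow> (nat \<Rightarrow> real) \<Rightarrow>
     (nat \<times> nat \<Rightarrow> real \<Rightarrow> 'w \<Rightarrow> real) \<Rightarrow> ('w \<Rightarrow> real \<Rightarrow> complex) \<Rightarrow> (nat \<Rightarrow> 'w \<Rightarrow> complex vec) \<Rightarrow> bool" where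
  "scheme_solution M J P \<tau> \<alpha> \<epsilon> lam \<eta> B \<psi>0 \<Psi> \<longleftrightarrow>
     (\<forall>n. \<forall>\<omega>\<in>space M. \<Psi> n \<omega> \<in> carrier_vec J) \<and>
     (AE \<omega> in M. \<Psi> 0 \<omega> = Matrix.vec J (\<lambda>j. \<psi>0 \<omega> (grid_point J (Suc j)))) \<and>
     (\<forall>n. AE \<omega> in M. scheme_step J P \<tau> \<alpha> \<epsilon> lam \<eta> (noise_increment P \<tau> B n \<omega>) (\<Psi> n \<omega>) (\<Psi> (Suc n) \<omega>))"

end

theory Submission
  imports Defs "Jordan_Normal_Form.Determinant"
begin

text \<open>With \<open>w = e\<^bsup>f(\<Psi>\<^sup>n)\<^esup> \<Psi>\<^sup>n\<close> one has \<open>|w|\<^sup>2 = e\<^bsup>-\<alpha>\<tau>\<^esup> |\<Psi>\<^sup>n|\<^sup>2\<close> componentwise, and the step is linear in \<open>w\<close> and the noise: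
  \<open>\<Psi>\<^bsup>n+1\<^esup> = K w + N \<delta>\<beta>\<close>. Since \<open>A\<close> is Hermitian, \<open>\<i>A\<close> drops out of the real part of every energy
  identity; testing the noiseless step with \<open>y + w\<close> shows that \<open>K\<close> is a contraction, and the resolvent
  gains the factor \<open>(1 + \<alpha>\<tau>/4)\<^bsup>-1\<^esup>\<close>. The increment \<open>\<delta>\<beta>\<close> is centred and independent of \<open>\<Psi>\<^sup>n\<close>, so second
  moments add, and the energies satisfy \<open>E\<^bsub>n+1\<^esub> \<le> q E\<^sub>n + (1 - q) C\<close> with \<open>q = e\<^bsup>-\<alpha>\<tau>\<^esup>\<close> and
  \<open>C = 8 \<epsilon>\<^sup>2 / \<alpha> \<cdot> \<Sum>\<^sub>k \<eta>\<^sub>k\<close>, uniformly in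
  \<open>\<tau>\<close>, because \<open>h J \<le> 1\<close> and \<open>|e\<^sub>k|\<^sup>2 \<le> 2\<close>.\<close>

section \<open>Second moments of Brownian increments\<close>

text \<open>Expanding the square, orthogonality kills the products of \<open>Y\<close> with each
  \<open>Z i\<close> and the products of distinct \<open>Z i\<close>; only the diagonal survives.
  Using \<open>has_bochner_integral\<close> keeps integrability and value together.\<close>

lemma has_bochner_integral_square_sum_orthogonal:
  fixes Y :: "'a \<Rightarrow> real" and Z :: "'i \<Rightarrow> 'a \<Rightarrow> real"
  assumes "has_bochner_integral M (\<lambda>\<omega>. (Y \<omega>)\<^sup>2) y"
    and "\<And>i. i \<in> I \<Longrightarrow> has_bochner_integral M (\<lambda>\<omega>. Y \<omega> * Z i \<omega>) 0"
    and "\<And>i j. i \<in> I \<Longrightarrow> j \<in> I \<Longrightarrow>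
           has_bochner_integral M (\<lambda>\<omega>. Z i \<omega> * Z j \<omega>) (if i = j then v else 0)"
    and "finite I"
  shows "has_bochner_integral M (\<lambda>\<omega>. (Y \<omega> + (\<Sum>i\<in>I. a i * Z i \<omega>))\<^sup>2) (y + v * (\<Sum>i\<in>I. (a i)\<^sup>2))"
proof -
  have "(\<lambda>\<omega>. (Y \<omega> + (\<Sum>i\<in>I. a i * Z i \<omega>))\<^sup>2) = (\<lambda>\<omega>. ((Y \<omega>)\<^sup>2 + (\<Sum>i\<in>I. 2 * a i * (Y \<omega> * Z i \<omega>)))
      + (\<Sum>i\<in>I. \<Sum>j\<in>I. a i * a j * (Z i \<omega> * Z j \<omega>)))"
    by (simp add: power2_sum power2_eq_square[of "sum _ _"] sum_product sum_distrib_left ac_simps)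
  \<comment> \<open>The value is padded with its vanishing terms so that it has literally the shape
    that the rules for sums produce.\<close>
  moreover have "y + v * (\<Sum>i\<in>I. (a i)\<^sup>2) = (y + (\<Sum>i\<in>I. 2 * a i * 0))
      + (\<Sum>i\<in>I. \<Sum>j\<in>I. a i * a j * (if i = j then v else 0))"
    using \<open>finite I\<close> by (simp add: sum.delta sum_distrib_left power2_eq_square mult_ac if_distrib cong: if_cong)
  moreover have "has_bochner_integral M (\<lambda>\<omega>. ((Y \<omega>)\<^sup>2 + (\<Sum>i\<in>I. 2 * a i * (Y \<omega> * Z i \<omega>)))
      + (\<Sum>i\<in>I. \<Sum>j\<in>I. a i * a j * (Z i \<omega> * Z j \<omega>)))
      ((y + (\<Sum>i\<in>I. 2 * a i * 0)) + (\<Sum>i\<in>I. \<Sum>j\<in>I. a i * a j * (if i = j then v else 0)))"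
    using assms(1-3)
    by (intro has_bochner_integral_add has_bochner_integral_sum has_bochner_integral_mult_right) auto
  ultimately show ?thesis by (simp only:)
qed

context prob_space
begin

lemma normal_distributed_moments:
  assumes D: "distributed M lborel Z (normal_density 0 \<sigma>)" and \<sigma>: "0 < \<sigma>"
  shows "has_bochner_integral M Z 0" "has_bochner_integral M (\<lambda>\<omega>. (Z \<omega>)\<^sup>2) (\<sigma>\<^sup>2)"
proof -
  have 1: "integrable M Z"
    using integrable_normal_moment[OF \<sigma>, of 0 1] distributed_integrable[OF D, of "\<lambda>x. x"] by simp
  have 2: "integrable M (\<lambda>\<omega>. (Z \<omega>)\<^sup>2)"
    using integrable_normal_moment[OF \<sigma>, of 0 2] distributed_integrable[OF D, of "\<lambda>x. x\<^sup>2"] by simp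
  show Z: "has_bochner_integral M Z 0"
    using 1 normal_distributed_expectation[OF \<sigma> D] by (simp add: has_bochner_integral_iff)
  show "has_bochner_integral M (\<lambda>\<omega>. (Z \<omega>)\<^sup>2) (\<sigma>\<^sup>2)"
    using 2 normal_distributed_variance[OF \<sigma> D] normal_distributed_expectation[OF \<sigma> D]
    by (simp add: has_bochner_integral_iff)
qed

text \<open>As \<open>X\<close> is \<open>N\<close>-measurable, the sigma-algebra it generates lies
  in \<open>N\<close>, so \<open>X\<close> and \<open>Z\<close> are independent and the expectation
  of the product factorises with the factor 0. This is how adaptedness to the filtration
  enters.\<close>

lemma has_bochner_integral_mult_indep_set:
  fixes X Z :: "'a \<Rightarrow> real"
  assumes sub: "subalgebra M N" and X: "X \<in> borel_measurable N" "integrable M X"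
    and Z: "has_bochner_integral M Z 0"
    and indep: "indep_set (sets N) (sets (vimage_algebra (space M) Z borel))"
  shows "has_bochner_integral M (\<lambda>\<omega>. X \<omega> * Z \<omega>) 0"
proof -
  have XN: "sigma_sets (space M) {X -` A \<inter> space M |A. A \<in> sets borel} \<subseteq> sets N"
    using X(1) sub sets.sigma_sets_subset[of "{X -` A \<inter> space N |A. A \<in> sets borel}" N]
    by (auto simp: subalgebra_def measurable_def)
  have "indep_set (sigma_sets (space M) {X -` A \<inter> space M |A. A \<in> sets borel})
          (sigma_sets (space M) {Z -` A \<inter> space M |A. A \<in> sets borel})"
    using indep XN unfolding indep_sets2_eq sets_vimage_algebra by blast
  then have "indep_var borel X borel Z"
    using X(2) Z by (auto simp: indep_var_eq has_bochner_integral_iff)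
  then show ?thesis
    using X(2) Z indep_var_lebesgue_integral[of X Z] indep_var_integrable[of X Z]
    by (simp add: has_bochner_integral_iff)
qed

end

text \<open>Orthogonality has two sources: an increment is independent of the past
  \<open>F s\<close>, and increments of different motions are independent because the motions are
  jointly independent.\<close>

lemma independent_brownian_motions_increments:
  assumes fps: "filtered_prob_space M F" and B: "independent_brownian_motions M F I B"
    and st: "0 \<le> s" "s < t"
  shows "i \<in> I \<Longrightarrow> (\<lambda>\<omega>. B i t \<omega> - B i s \<omega>) \<in> borel_measurable (F t)"
    and "i \<in> I \<Longrightarrow> X \<in> borel_measurable (F s) \<Longrightarrow> integrable M X \<Longrightarrow>
      has_bochner_integral M (\<lambda>\<omega>. X \<omega> * (B i t \<omega> - B i s \<omega>)) 0"
    and "i \<in> I \<Longrightarrow> j \<in> I \<Longrightarrow> has_bochner_integral M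
      (\<lambda>\<omega>. (B i t \<omega> - B i s \<omega>) * (B j t \<omega> - B j s \<omega>)) (if i = j then t - s else 0)"
proof -
  interpret prob_space M using fps by (simp add: filtered_prob_space_def)
  interpret filtration "space M" F using fps by (simp add: filtered_prob_space_def)
  have sub: "subalgebra M (F s)" using fps st by (auto simp: filtered_prob_space_def)
  have sub_st: "subalgebra (F t) (F s)"
    using sets_F_mono[of s t] st by (auto simp: subalgebra_def space_F)
  have bm: "standard_brownian_motion M F (B i)" if "i \<in> I" for i
    using B that by (simp add: independent_brownian_motions_def)
  have d: "distributed M lborel (\<lambda>\<omega>. B i t \<omega> - B i s \<omega>) (normal_density 0 (sqrt (t - s)))"
    "indep_set (sets (F s)) (sets (vimage_algebra (space M) (\<lambda>\<omega>. B i t \<omega> - B i s \<omega>) borel))" if "i \<in> I" for i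
    using bm[OF that] st by (auto simp: standard_brownian_motion_def)
  have m: "has_bochner_integral M (\<lambda>\<omega>. B i t \<omega> - B i s \<omega>) 0"
    "has_bochner_integral M (\<lambda>\<omega>. (B i t \<omega> - B i s \<omega>)\<^sup>2) (t - s)" if "i \<in> I" for i
    using normal_distributed_moments[OF d(1)[OF that]] st by auto
  show "(\<lambda>\<omega>. B i t \<omega> - B i s \<omega>) \<in> borel_measurable (F t)" if "i \<in> I"
    using bm[OF that] st measurable_from_subalg[OF sub_st, of "B i s" borel]
    by (auto simp: standard_brownian_motion_def intro!: borel_measurable_diff)
  show "has_bochner_integral M (\<lambda>\<omega>. X \<omega> * (B i t \<omega> - B i s \<omega>)) 0"
    if "i \<in> I" "X \<in> borel_measurable (F s)" "integrable M X"
    using has_bochner_integral_mult_indep_set[OF sub that(2,3) m(1)[OF that(1)] d(2)[OF that(1)]] .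
  show "has_bochner_integral M
      (\<lambda>\<omega>. (B i t \<omega> - B i s \<omega>) * (B j t \<omega> - B j s \<omega>)) (if i = j then t - s else 0)" if ij: "i \<in> I" "j \<in> I"
  proof (cases "i = j")
    case True
    then show ?thesis using m(2)[OF ij(1)] by (simp add: power2_eq_square)
  next
    case False
    have "indep_vars (\<lambda>_. Pi\<^sub>M {0..} (\<lambda>_. borel)) (\<lambda>i \<omega>. \<lambda>t\<in>{0..}. B i t \<omega>) {i, j}"
      using B ij by (auto simp: independent_brownian_motions_def intro: indep_vars_subset)
    \<comment> \<open>The increment is the measurable function \<open>p t - p s\<close> of the path
      \<open>p\<close>, so independence of paths in the product space passes to increments; the mean
      of the product is then a product of zeros.\<close>
    from indep_vars_compose2[OF this, of "\<lambda>_ p. p t - p s" "\<lambda>_. borel"] st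
    have iv: "indep_vars (\<lambda>_. borel) (\<lambda>i \<omega>. B i t \<omega> - B i s \<omega>) {i, j}"
      by (simp add: measurable_component_singleton)
    show ?thesis
      using indep_vars_lebesgue_integral[OF _ iv] indep_vars_integrable[OF _ iv] m(1) ij False
      by (auto simp: has_bochner_integral_iff)
  qed
qed

text \<open>Passes from the indices \<open>(k, i)\<close> of the real motions, which start at 1, to
  the columns \<open>k < P\<close> of the matrices, which start at 0.\<close>

lemma sum_Suc_Times_12:
  fixes f :: "nat \<times> nat \<Rightarrow> 'a::comm_monoid_add"
  shows "(\<Sum>p\<in>{1..P} \<times> {1, 2}. f p) = (\<Sum>k<P. f (Suc k, 1) + f (Suc k, 2))"
proof -
  have "(\<Sum>p\<in>{1..P} \<times> {1, 2}. f p) = (\<Sum>k=1..P. \<Sum>i\<in>{1, 2}. f (k, i))"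
    by (subst sum.cartesian_product) (simp add: split_def)
  also have "\<dots> = (\<Sum>k<P. \<Sum>i\<in>{1, 2}. f (Suc k, i))" by (simp only: One_nat_def sum.atLeast1_atMost_eq)
  finally show ?thesis by simp
qed

text \<open>The real and imaginary parts of \<open>U\<close> are real affine combinations of the
  \<open>2 * P\<close> real increments, and the orthogonality lemma applies to each. Both
  coefficient families have square sum equal to that of the \<open>cmod (a k)\<close>, whence the
  factor 2.\<close>

lemma additive_noise_second_moment:
  fixes a :: "nat \<Rightarrow> complex" and B :: "nat \<times> nat \<Rightarrow> real \<Rightarrow> 'w \<Rightarrow> real"
  assumes fps: "filtered_prob_space M F" and B: "independent_brownian_motions M F ({1..P} \<times> {1, 2}) B"
    and st: "0 \<le> s" "s < t"
    and Y: "Y \<in> borel_measurable (F s)" "integrable M (\<lambda>\<omega>. (cmod (Y \<omega>))\<^sup>2)"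
  defines "U \<equiv> \<lambda>\<omega>. Y \<omega> + (\<Sum>k<P. a k * Complex (B (Suc k, 1) t \<omega> - B (Suc k, 1) s \<omega>)
                                                  (B (Suc k, 2) t \<omega> - B (Suc k, 2) s \<omega>))"
  shows "U \<in> borel_measurable (F t)"
    and "has_bochner_integral M (\<lambda>\<omega>. (cmod (U \<omega>))\<^sup>2)
           ((LINT \<omega>|M. (cmod (Y \<omega>))\<^sup>2) + 2 * (t - s) * (\<Sum>k<P. (cmod (a k))\<^sup>2))"
proof -
  interpret prob_space M using fps by (simp add: filtered_prob_space_def)
  interpret filtration "space M" F using fps by (simp add: filtered_prob_space_def)
  have sub: "subalgebra M (F s)" using fps st by (auto simp: filtered_prob_space_def)
  have sub_st: "subalgebra (F t) (F s)"
    using sets_F_mono[of s t] st by (auto simp: subalgebra_def space_F)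
  define I where "I = {1..P} \<times> {1, 2::nat}"
  define Z where "Z p \<omega> = B p t \<omega> - B p s \<omega>" for p \<omega>
  note inc = independent_brownian_motions_increments[OF fps B st, folded Z_def I_def]
  \<comment> \<open>For \<open>z = a k * Complex x y\<close>, the real part is
    \<open>Re (a k) * x - Im (a k) * y\<close> and the imaginary part
    \<open>Im (a k) * x + Re (a k) * y\<close>; \<open>fst p - 1\<close> undoes the index
    shift.\<close>
  define a1 where "a1 p = (if snd p = 1 then Re (a (fst p - 1)) else - Im (a (fst p - 1)))" for p :: "nat \<times> nat"
  define a2 where "a2 p = (if snd p = 1 then Im (a (fst p - 1)) else Re (a (fst p - 1)))" for p :: "nat \<times> nat"
  have U: "U \<omega> = Y \<omega> + (\<Sum>k<P. a k * Complex (Z (Suc k, 1) \<omega>) (Z (Suc k, 2) \<omega>))" for \<omega>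
    by (simp add: U_def Z_def)
  have ReU: "Re (U \<omega>) = Re (Y \<omega>) + (\<Sum>p\<in>I. a1 p * Z p \<omega>)" for \<omega>
    unfolding U I_def sum_Suc_Times_12 a1_def by simp
  have ImU: "Im (U \<omega>) = Im (Y \<omega>) + (\<Sum>p\<in>I. a2 p * Z p \<omega>)" for \<omega>
    unfolding U I_def sum_Suc_Times_12 a2_def by (simp add: add.commute)
  have Yt: "Y \<in> borel_measurable (F t)" using measurable_from_subalg[OF sub_st Y(1)] .
  have YM: "Y \<in> borel_measurable M" using measurable_from_subalg[OF sub Y(1)] .
  have U': "U = (\<lambda>\<omega>. complex_of_real (Re (U \<omega>)) + \<i> * complex_of_real (Im (U \<omega>)))"
    by (simp add: complex_eq[symmetric])
  have "(\<lambda>\<omega>. Re (U \<omega>)) \<in> borel_measurable (F t)" "(\<lambda>\<omega>. Im (U \<omega>)) \<in> borel_measurable (F t)"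
    unfolding ReU ImU using Yt inc(1) by (auto intro!: borel_measurable_add borel_measurable_sum borel_measurable_times)
  then show "U \<in> borel_measurable (F t)"
    by (subst U') (intro borel_measurable_add borel_measurable_times borel_measurable_const
        measurable_compose[OF _ borel_measurable_of_real])
  \<comment> \<open>\<open>X\<close> stands for \<open>Re\<close> or \<open>Im\<close>. Its square
    is dominated by the squared modulus; on a probability space \<open>X (Y \<omega>)\<close> itself
    is then integrable, as the product with an increment requires.\<close>
  have XX: "integrable M (\<lambda>\<omega>. (X (Y \<omega>))\<^sup>2)" "integrable M (\<lambda>\<omega>. X (Y \<omega>))"
    if "X \<in> borel_measurable borel" and le: "\<And>z. \<bar>X z\<bar> \<le> cmod z" for X :: "complex \<Rightarrow> real"
  proof -
    have m: "(\<lambda>\<omega>. X (Y \<omega>)) \<in> borel_measurable M" using measurable_compose[OF YM that(1)] .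
    show "integrable M (\<lambda>\<omega>. (X (Y \<omega>))\<^sup>2)"
      using Y(2) by (rule Bochner_Integration.integrable_bound)
        (use m power_mono[OF le, of _ 2] in \<open>auto intro!: borel_measurable_power\<close>)
    then show "integrable M (\<lambda>\<omega>. X (Y \<omega>))"
      using m by (rule square_integrable_imp_integrable[rotated])
  qed
  have comp: "has_bochner_integral M (\<lambda>\<omega>. (X (Y \<omega>) + (\<Sum>p\<in>I. c p * Z p \<omega>))\<^sup>2)
      ((LINT \<omega>|M. (X (Y \<omega>))\<^sup>2) + (t - s) * (\<Sum>p\<in>I. (c p)\<^sup>2))"
    if X: "X \<in> borel_measurable borel" and le: "\<And>z. \<bar>X z\<bar> \<le> cmod z" for X :: "complex \<Rightarrow> real" and c
  proof (rule has_bochner_integral_square_sum_orthogonal)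
    show "has_bochner_integral M (\<lambda>\<omega>. (X (Y \<omega>))\<^sup>2) (LINT \<omega>|M. (X (Y \<omega>))\<^sup>2)"
      using XX(1)[OF that] by (rule has_bochner_integral_integrable)
    show "has_bochner_integral M (\<lambda>\<omega>. X (Y \<omega>) * Z p \<omega>) 0" if "p \<in> I" for p
      using inc(2)[OF that measurable_compose[OF Y(1) X] XX(2)[OF X le]] .
    show "has_bochner_integral M (\<lambda>\<omega>. Z p \<omega> * Z r \<omega>) (if p = r then t - s else 0)" if "p \<in> I" "r \<in> I" for p r
      using inc(3)[OF that] .
  qed (simp add: I_def)
  have "has_bochner_integral M (\<lambda>\<omega>. (Re (U \<omega>))\<^sup>2 + (Im (U \<omega>))\<^sup>2)
    (((LINT \<omega>|M. (Re (Y \<omega>))\<^sup>2) + (t - s) * (\<Sum>p\<in>I. (a1 p)\<^sup>2)) + ((LINT \<omega>|M. (Im (Y \<omega>))\<^sup>2) + (t - s) * (\<Sum>p\<in>I. (a2 p)\<^sup>2)))"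
    unfolding ReU ImU
    by (intro has_bochner_integral_add comp) (auto simp: abs_Re_le_cmod abs_Im_le_cmod)
  moreover have "(LINT \<omega>|M. (cmod (Y \<omega>))\<^sup>2) = (LINT \<omega>|M. (Re (Y \<omega>))\<^sup>2) + (LINT \<omega>|M. (Im (Y \<omega>))\<^sup>2)"
    unfolding cmod_power2
    by (intro Bochner_Integration.integral_add XX(1)) (auto simp: abs_Re_le_cmod abs_Im_le_cmod)
  moreover have "(\<Sum>p\<in>I. (a1 p)\<^sup>2) = (\<Sum>k<P. (cmod (a k))\<^sup>2)"
    unfolding I_def sum_Suc_Times_12 a1_def by (simp add: cmod_power2)
  moreover have "(\<Sum>p\<in>I. (a2 p)\<^sup>2) = (\<Sum>k<P. (cmod (a k))\<^sup>2)"
    unfolding I_def sum_Suc_Times_12 a2_def by (simp add: cmod_power2 add.commute)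
  ultimately show "has_bochner_integral M (\<lambda>\<omega>. (cmod (U \<omega>))\<^sup>2)
           ((LINT \<omega>|M. (cmod (Y \<omega>))\<^sup>2) + 2 * (t - s) * (\<Sum>k<P. (cmod (a k))\<^sup>2))"
    by (simp add: cmod_power2 algebra_simps)
qed

section \<open>Summability of the eigenvalues\<close>

lemma prob_space_unit_measure: "prob_space unit_measure"
  by (intro prob_spaceI) (simp add: emeasure_restrict_space)

text \<open>The unit interval is a probability space, so the inequality is the nonnegativity of the
  variance of \<open>cmod (u x)\<close>.\<close>

lemma L1_le_L2_norm:
  assumes "in_L2 u"
  shows "integrable unit_measure u" "(LINT x|unit_measure. cmod (u x)) \<le> L2_norm u"
proof -
  interpret U: prob_space unit_measure by (rule prob_space_unit_measure)
  have u: "u \<in> borel_measurable unit_measure" "integrable unit_measure (\<lambda>x. (cmod (u x))\<^sup>2)"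
    using assms by (auto simp: in_L2_def)
  have n: "integrable unit_measure (\<lambda>x. cmod (u x))"
    using measurable_compose[OF u(1) borel_measurable_norm] u(2) by (rule U.square_integrable_imp_integrable)
  then show "integrable unit_measure u"
    using u(1) by (simp add: integrable_norm_iff)
  have "0 \<le> U.variance (\<lambda>x. cmod (u x))" by (intro Bochner_Integration.integral_nonneg) auto
  then have "(LINT x|unit_measure. cmod (u x))\<^sup>2 \<le> (LINT x|unit_measure. (cmod (u x))\<^sup>2)"
    using U.variance_eq[OF n u(2)] by simp
  then show "(LINT x|unit_measure. cmod (u x)) \<le> L2_norm u"
    unfolding L2_norm_def by (rule real_le_rsqrt)
qed

text \<open>For \<open>x \<le> 1\<close> the interval of integration lies in the unit interval, so
  the primitive is bounded by the L1 norm of \<open>g\<close>, hence by its L2 norm.\<close>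

lemma norm_primitive_le_L2_norm:
  assumes "in_L2 g" "x \<le> 1"
  shows "cmod (LINT y:{0<..<x}|lborel. g y) \<le> L2_norm g"
proof -
  have "(LINT y:{0<..<x}|lborel. g y) = (LINT y|unit_measure. indicat_real {0<..<x} y *\<^sub>R g y)"
    using \<open>x \<le> 1\<close> unfolding set_lebesgue_integral_def
    by (subst integral_restrict_space) (auto intro!: Bochner_Integration.integral_cong simp: indicator_def)
  also have "cmod \<dots> \<le> (LINT y|unit_measure. cmod (g y))"
    using L1_le_L2_norm(1)[OF assms(1)]
    by (intro order_trans[OF integral_norm_bound] integral_mono' integrable_norm)
      (auto simp: indicator_def)
  also have "\<dots> \<le> L2_norm g" by (rule L1_le_L2_norm(2)[OF assms(1)])
  finally show ?thesis .
qed

text \<open>The set \<open>T\<close> where the functions agree is dense in the closed interval, end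
  points included, and the zero set of \<open>f - g\<close> is closed.\<close>

lemma continuous_AE_unit_measure_eq:
  fixes f g :: "real \<Rightarrow> 'a::real_normed_vector"
  assumes f: "continuous_on {0..1} f" and g: "continuous_on {0..1} g"
    and ae: "AE x in unit_measure. f x = g x" and x: "x \<in> {0..1}"
  shows "f x = g x"
proof -
  define T where "T = {y\<in>{0<..<1}. f y = g y}"
  have "AE y in lborel. y \<in> {0<..<1} \<longrightarrow> f y = g y"
    using ae by (subst (asm) AE_restrict_space_iff) auto
  then obtain S where S: "S \<in> null_sets lborel" "{y. \<not> (y \<in> {0<..<1} \<longrightarrow> f y = g y)} \<subseteq> S"
    by (auto simp: eventually_ae_filter)
  have "x \<in> closure T"
    unfolding closure_approachable
  proof (intro allI impI)
    fix e :: real assume e: "0 < e"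
    define a b where "a = max 0 (x - e)" and "b = min 1 (x + e)"
    have "a < b" using x e by (auto simp: a_def b_def)
    \<comment> \<open>The ball around \<open>x\<close>, clipped to the unit interval, is a nonempty
      open interval; it has positive measure and cannot lie in the exceptional null set.\<close>
    have "\<not> {a<..<b} \<subseteq> S"
    proof
      assume "{a<..<b} \<subseteq> S"
      then have "{a<..<b} \<in> null_sets lborel" by (intro null_sets_subset[OF S(1)]) auto
      then show False using \<open>a < b\<close> by (simp add: null_sets_def)
    qed
    then obtain y where "y \<in> {a<..<b}" "y \<notin> S" by blast
    then show "\<exists>y\<in>T. dist y x < e"
      using S(2) by (intro bexI[of _ y]) (auto simp: T_def a_def b_def dist_real_def)
  qed
  moreover have "closure T \<subseteq> {y\<in>{0..1}. f y - g y = 0}"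
    using continuous_closed_preimage_constant[OF continuous_on_diff[OF f g], of 0]
    by (intro closure_minimal) (auto simp: T_def)
  ultimately show ?thesis by auto
qed

text \<open>The Laplacian \<open>g\<close> is only accessible through its primitive \<open>w - w 0 = u' - u' 0\<close>; for
  \<open>u = c e\<^sub>k\<close> this primitive is large at \<open>x = 1/k\<close>, half a period of \<open>e\<^sub>k\<close> away from 0.\<close>

lemma dirichlet_laplacian_sine_lower_bound:
  assumes lap: "dirichlet_laplacian u g" and k: "1 \<le> k" and c: "0 \<le> c"
    and u: "AE x in unit_measure. u x = complex_of_real c * sine_basis k x"
  shows "c \<le> L2_norm g"
proof -
  obtain v w where v: "AE x in unit_measure. u x = v x"
      "\<And>x. x \<in> {0..1} \<Longrightarrow> (v has_vector_derivative w x) (at x within {0..1})"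
    and w: "\<And>x. x \<in> {0..1} \<Longrightarrow> w x = w 0 + (LINT y:{0<..<x}|lborel. g y)" and g: "in_L2 g"
    using lap unfolding dirichlet_laplacian_def by blast
  \<comment> \<open>\<open>p\<close> is the smooth representative of \<open>u\<close> and
    \<open>p'\<close> its derivative. They are identified with \<open>v\<close> and
    \<open>w\<close>, first up to null sets and then everywhere on the closed interval.\<close>
  define p where "p x = complex_of_real (c * (sqrt 2 * sin (real k * pi * x)))" for x
  define p' where "p' x = complex_of_real (c * (sqrt 2 * (cos (real k * pi * x) * (real k * pi))))" for x
  have dp: "(p has_vector_derivative p' x) (at x within T)" for x T
    unfolding p_def p'_def
    by (intro has_vector_derivative_of_real has_real_derivative_iff_has_vector_derivative[THEN iffD1])
      (auto intro!: derivative_eq_intros)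
  have "AE x in unit_measure. v x = p x"
    using v(1) u by eventually_elim (simp add: p_def sine_basis_def)
  then have vp: "v x = p x" if "x \<in> {0..1}" for x
    using that by (intro continuous_AE_unit_measure_eq[of v p x]
        continuous_on_vector_derivative[OF v(2)] continuous_on_vector_derivative[OF dp])
  \<comment> \<open>Derivatives within the closed interval are unique also at its end points, so
    \<open>w 0\<close> is identified too.\<close>
  have wp: "w x = p' x" if x: "x \<in> {0..1}" for x
  proof -
    have "(v has_vector_derivative p' x) (at x within {0..1})"
      using dp[of x "{0..1}"] by (rule has_vector_derivative_transform[OF x, rotated]) (simp add: vp)
    then show ?thesis
      using vector_derivative_unique_within_closed_interval[of 0 1 x v "w x" "p' x"] x v(2)[OF x] by simp
  qed
  have x: "1 / real k \<in> {0..1}" using k by auto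
  have "p' (1 / real k) - p' 0 = (LINT y:{0<..<1 / real k}|lborel. g y)"
    using w[OF x] wp[OF x] wp[of 0] by simp
  \<comment> \<open>The cosine falls from 1 at 0 to -1 at \<open>1 / real k\<close>, which gives the
    factor 2.\<close>
  moreover have "p' (1 / real k) - p' 0 = complex_of_real (- (2 * sqrt 2 * real k * pi * c))"
    using k by (simp add: p'_def)
  ultimately have "\<bar>2 * sqrt 2 * real k * pi * c\<bar> \<le> L2_norm g"
    using norm_primitive_le_L2_norm[OF g, of "1 / real k"] x
    by (metis abs_minus_cancel atLeastAtMost_iff norm_of_real)
  \<comment> \<open>The factor is at least 1 for every \<open>k \<ge> 1\<close>; this crude bound
    suffices for comparing \<open>\<eta> k\<close> with the Hilbert-Schmidt series.\<close>
  moreover have "1 * c \<le> (2 * sqrt 2 * real k * pi) * c"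
  proof (rule mult_right_mono[OF _ c])
    have "1 * 1 * 1 * 1 \<le> 2 * sqrt 2 * real k * pi"
      using k pi_gt3 by (intro mult_mono) auto
    then show "1 \<le> 2 * sqrt 2 * real k * pi" by simp
  qed
  ultimately show ?thesis by simp
qed

lemma cmod_sine_basis_sq_le: "(cmod (sine_basis k x))\<^sup>2 \<le> 2"
proof -
  have "(cmod (sine_basis k x))\<^sup>2 = 2 * (sin (real k * pi * x))\<^sup>2"
    by (simp add: sine_basis_def norm_mult power_mult_distrib)
  then show ?thesis using abs_sin_le_one[of "real k * pi * x"] by (simp add: abs_square_le_1)
qed

lemma in_L2_sine_basis: "in_L2 (sine_basis k)"
proof -
  interpret U: prob_space unit_measure by (rule prob_space_unit_measure)
  have "sine_basis k \<in> borel_measurable borel"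
    unfolding sine_basis_def by (intro borel_measurable_continuous_onI continuous_intros)
  then have m: "sine_basis k \<in> borel_measurable unit_measure"
    by (intro measurable_restrict_space1) simp
  then have "integrable unit_measure (\<lambda>x. (cmod (sine_basis k x))\<^sup>2)"
    by (intro U.integrable_const_bound[of _ 2]) (auto simp: cmod_sine_basis_sq_le)
  with m show ?thesis by (simp add: in_L2_def)
qed

text \<open>Comparison with the Hilbert-Schmidt series: \<open>sqrt (\<eta> k)\<close> is at most
  the norm of \<open>Q e_k\<close> in the domain of the Laplacian, and squaring gives the
  terms.\<close>

lemma summable_eigenvalues:
  assumes HS: "hilbert_schmidt_L2_Hdot2 Q"
    and \<eta>: "\<And>k. 1 \<le> k \<Longrightarrow> 0 \<le> \<eta> k \<and>
      (AE x in unit_measure. Q (sine_basis k) x = complex_of_real (sqrt (\<eta> k)) * sine_basis k x)"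
  shows "summable (\<lambda>k. \<eta> (Suc k))"
proof (rule summable_comparison_test'[where N = 0])
  show "summable (\<lambda>k. (Hdot2_norm (Q (sine_basis (Suc k))))\<^sup>2)"
    using HS by (simp add: hilbert_schmidt_L2_Hdot2_def)
  fix k
  have "in_L2 (sine_basis (Suc k))" by (rule in_L2_sine_basis)
  then have "\<exists>g. dirichlet_laplacian (Q (sine_basis (Suc k))) g"
    using HS by (auto simp: hilbert_schmidt_L2_Hdot2_def in_Hdot2_def)
  \<comment> \<open>\<open>Hdot2_norm\<close> selects a Laplacian by choice. As \<open>Q\<close>
    maps into the domain, the selected function is a genuine Laplacian and the lower bound applies
    to it.\<close>
  then have lap: "dirichlet_laplacian (Q (sine_basis (Suc k))) (SOME g. dirichlet_laplacian (Q (sine_basis (Suc k))) g)"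
    by (rule someI_ex)
  have "sqrt (\<eta> (Suc k)) \<le> Hdot2_norm (Q (sine_basis (Suc k)))"
    unfolding Hdot2_norm_def
    using \<eta>[of "Suc k"] by (intro dirichlet_laplacian_sine_lower_bound[OF lap, of "Suc k"]) auto
  then show "norm (\<eta> (Suc k)) \<le> (Hdot2_norm (Q (sine_basis (Suc k))))\<^sup>2"
    using \<eta>[of "Suc k"] power_mono[of "sqrt (\<eta> (Suc k))" _ 2] by simp
qed

section \<open>The linear step of the scheme\<close>

lemma mult_mat_vec_nth:
  "A \<in> carrier_mat m n \<Longrightarrow> v \<in> carrier_vec n \<Longrightarrow> i < m \<Longrightarrow>
    (A *\<^sub>v v) $ i = (\<Sum>k<n. A $$ (i, k) * v $ k)"
  by (auto simp: scalar_prod_def lessThan_atLeast0)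

lemma smult_one_plus_smult_mult_vec_nth:
  fixes A :: "'a::comm_ring_1 mat"
  assumes A: "A \<in> carrier_mat n n" and v: "v \<in> carrier_vec n" "i < n"
  shows "((a \<cdot>\<^sub>m 1\<^sub>m n + e \<cdot>\<^sub>m A) *\<^sub>v v) $ i = a * v $ i + e * (A *\<^sub>v v) $ i"
proof -
  have B: "a \<cdot>\<^sub>m 1\<^sub>m n + e \<cdot>\<^sub>m A \<in> carrier_mat n n" using A by simp
  have "((a \<cdot>\<^sub>m 1\<^sub>m n + e \<cdot>\<^sub>m A) *\<^sub>v v) $ i
      = (\<Sum>k<n. (if i = k then a * v $ k else 0) + e * (A $$ (i, k) * v $ k))"
    unfolding mult_mat_vec_nth[OF B v] using A v by (intro sum.cong) (auto simp: algebra_simps)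
  then show ?thesis
    using v by (simp add: sum.distrib sum.delta' mult_mat_vec_nth[OF A v] sum_distrib_left)
qed

lemma smult_mat_mult_mat_vec:
  fixes A :: "'a::comm_ring_1 mat"
  assumes A: "A \<in> carrier_mat m n" and v: "v \<in> carrier_vec n"
  shows "(a \<cdot>\<^sub>m A) *\<^sub>v v = a \<cdot>\<^sub>v (A *\<^sub>v v)"
proof (rule eq_vecI)
  fix i assume "i < dim_vec (a \<cdot>\<^sub>v (A *\<^sub>v v))"
  then have i: "i < m" using A by simp
  have aA: "a \<cdot>\<^sub>m A \<in> carrier_mat m n" using A by simp
  have "((a \<cdot>\<^sub>m A) *\<^sub>v v) $ i = a * (A *\<^sub>v v) $ i"
    unfolding mult_mat_vec_nth[OF aA v i] mult_mat_vec_nth[OF A v i]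
    using A i by (simp add: sum_distrib_left mult.assoc)
  then show "((a \<cdot>\<^sub>m A) *\<^sub>v v) $ i = (a \<cdot>\<^sub>v (A *\<^sub>v v)) $ i"
    using A i by simp
qed (use A in simp)

text \<open>Conjugating the double sum exchanges its two indices, so the form equals its own
  conjugate.\<close>

lemma hermitian_form_real:
  assumes A: "A \<in> carrier_mat n n" and herm: "\<And>i j. i < n \<Longrightarrow> j < n \<Longrightarrow> A $$ (j, i) = cnj (A $$ (i, j))"
    and v: "v \<in> carrier_vec n"
  shows "Im (\<Sum>i<n. cnj (v $ i) * (A *\<^sub>v v) $ i) = 0"
proof -
  let ?S = "\<Sum>i<n. \<Sum>j<n. cnj (v $ i) * (A $$ (i, j) * v $ j)"
  have "cnj ?S = (\<Sum>i<n. \<Sum>j<n. cnj (v $ j) * (A $$ (j, i) * v $ i))"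
    unfolding cnj_sum
  proof (intro sum.cong refl)
    fix i j assume "i \<in> {..<n}" "j \<in> {..<n}"
    then show "cnj (cnj (v $ i) * (A $$ (i, j) * v $ j)) = cnj (v $ j) * (A $$ (j, i) * v $ i)"
      using herm[of i j] by simp
  qed
  also have "\<dots> = ?S" by (rule sum.swap)
  finally have "cnj ?S = ?S" .
  moreover have "Im z = 0" if "cnj z = z" for z
    using that by (simp add: complex_eq_iff)
  ultimately have "Im ?S = 0" by blast
  moreover have "(\<Sum>i<n. cnj (v $ i) * (A *\<^sub>v v) $ i) = ?S"
    using mult_mat_vec_nth[OF A v] by (simp add: sum_distrib_left)
  ultimately show ?thesis by simp
qed

section \<open>Energy estimates and solvability of the Crank-Nicolson step\<close>

lemma sq_norm_ge_0: "0 \<le> sq_norm v"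
  by (simp add: sq_norm_def sum_nonneg)

lemma sq_norm_eq_0: "v \<in> carrier_vec n \<Longrightarrow> sq_norm v = 0 \<longleftrightarrow> v = 0\<^sub>v n"
  by (auto simp: sq_norm_def sum_nonneg_eq_0_iff)

lemma crank_nicolson_contraction:
  assumes A: "A \<in> carrier_mat n n" and herm: "\<And>i j. i < n \<Longrightarrow> j < n \<Longrightarrow> A $$ (j, i) = cnj (A $$ (i, j))"
    and v: "y \<in> carrier_vec n" "w \<in> carrier_vec n" and b: "0 \<le> b"
    and eq: "y - w = (\<i> * complex_of_real c) \<cdot>\<^sub>v (A *\<^sub>v (y + w)) - complex_of_real b \<cdot>\<^sub>v (y + w)"
  shows "sq_norm y \<le> sq_norm w"
proof -
  define z where "z = y + w"
  have z: "z \<in> carrier_vec n" using v by (simp add: z_def)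
  \<comment> \<open>Componentwise, \<open>Re (cnj (y + w) * (y - w))\<close> is the difference of
    squared moduli. The imaginary parts need not vanish one by one; only their sum over
    \<open>i\<close> does.\<close>
  have "(cmod (y $ i))\<^sup>2 - (cmod (w $ i))\<^sup>2 = - c * Im (cnj (z $ i) * (A *\<^sub>v z) $ i) - b * (cmod (z $ i))\<^sup>2"
    if i: "i < n" for i
  proof -
    have e: "y $ i - w $ i = \<i> * complex_of_real c * (A *\<^sub>v z) $ i - complex_of_real b * z $ i"
      using arg_cong[OF eq, of "\<lambda>v. v $ i"] i v A z unfolding z_def[symmetric] by simp
    have "(cmod (y $ i))\<^sup>2 - (cmod (w $ i))\<^sup>2 = Re (cnj (z $ i) * (y $ i - w $ i))"
      unfolding cmod_power2 using i v by (simp add: z_def power2_eq_square algebra_simps)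
    also have "\<dots> = - c * Im (cnj (z $ i) * (A *\<^sub>v z) $ i) - b * (cmod (z $ i))\<^sup>2"
      unfolding e cmod_power2 by (simp add: power2_eq_square algebra_simps)
    finally show ?thesis .
  qed
  then have "sq_norm y - sq_norm w = (\<Sum>i<n. - c * Im (cnj (z $ i) * (A *\<^sub>v z) $ i) - b * (cmod (z $ i))\<^sup>2)"
    using v by (simp add: sq_norm_def sum_subtractf[symmetric])
  also have "\<dots> = - c * Im (\<Sum>i<n. cnj (z $ i) * (A *\<^sub>v z) $ i) - b * sq_norm z"
    using z by (simp only: sum_subtractf sum_distrib_left sq_norm_def Im_sum carrier_vecD)
  finally show ?thesis
    using hermitian_form_real[OF A herm z] mult_nonneg_nonneg[OF b sq_norm_ge_0[of z]] by simp
qed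

text \<open>With \<open>r = (1 + b) y - \<i> c A y\<close>, the square of \<open>r\<close> is
  expanded. The cross term is a multiple of the imaginary part of the Hermitian form and sums to 0,
  and the square of \<open>c A y\<close> is dropped.\<close>

lemma crank_nicolson_resolvent_bound:
  assumes A: "A \<in> carrier_mat n n" and herm: "\<And>i j. i < n \<Longrightarrow> j < n \<Longrightarrow> A $$ (j, i) = cnj (A $$ (i, j))"
    and v: "y \<in> carrier_vec n" "r \<in> carrier_vec n"
    and eq: "y = (\<i> * complex_of_real c) \<cdot>\<^sub>v (A *\<^sub>v y) - complex_of_real b \<cdot>\<^sub>v y + r"
  shows "(1 + b)\<^sup>2 * sq_norm y \<le> sq_norm r"
proof -
  have "(1 + b)\<^sup>2 * (cmod (y $ i))\<^sup>2 + 2 * (1 + b) * c * Im (cnj (y $ i) * (A *\<^sub>v y) $ i) \<le> (cmod (r $ i))\<^sup>2"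
    if i: "i < n" for i
  proof -
    have "y $ i = \<i> * complex_of_real c * (A *\<^sub>v y) $ i - complex_of_real b * y $ i + r $ i"
      using arg_cong[OF eq, of "\<lambda>v. v $ i"] i v A by simp
    then have r: "r $ i = complex_of_real (1 + b) * y $ i - \<i> * complex_of_real c * (A *\<^sub>v y) $ i"
      by (simp add: algebra_simps)
    have "(cmod (r $ i))\<^sup>2 = (1 + b)\<^sup>2 * (cmod (y $ i))\<^sup>2 + c\<^sup>2 * (cmod ((A *\<^sub>v y) $ i))\<^sup>2
       + 2 * (1 + b) * c * Im (cnj (y $ i) * (A *\<^sub>v y) $ i)"
      unfolding r cmod_power2 by (simp add: power2_eq_square algebra_simps)
    then show ?thesis by simp
  qed
  then have "(\<Sum>i<n. (1 + b)\<^sup>2 * (cmod (y $ i))\<^sup>2 + 2 * (1 + b) * c * Im (cnj (y $ i) * (A *\<^sub>v y) $ i)) \<le> sq_norm r"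
    using v by (auto simp: sq_norm_def intro!: sum_mono)
  moreover have "(\<Sum>i<n. (1 + b)\<^sup>2 * (cmod (y $ i))\<^sup>2 + 2 * (1 + b) * c * Im (cnj (y $ i) * (A *\<^sub>v y) $ i))
    = (1 + b)\<^sup>2 * sq_norm y + 2 * (1 + b) * c * Im (\<Sum>i<n. cnj (y $ i) * (A *\<^sub>v y) $ i)"
    using v by (simp only: sum.distrib sum_distrib_left sq_norm_def Im_sum carrier_vecD)
  ultimately show ?thesis
    using hermitian_form_real[OF A herm v(1)] by simp
qed

text \<open>The matrix \<open>B = (1 + b) I - \<i> c A\<close> is injective by the resolvent bound
  with right-hand side 0, hence invertible, and \<open>G\<close> is its inverse. The equivalence
  gives existence and uniqueness of the implicit step at once.\<close>

lemma crank_nicolson_resolvent: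
  assumes A: "A \<in> carrier_mat n n" and herm: "\<And>i j. i < n \<Longrightarrow> j < n \<Longrightarrow> A $$ (j, i) = cnj (A $$ (i, j))"
    and b: "0 \<le> b"
  obtains G where "G \<in> carrier_mat n n"
    "\<And>y r. y \<in> carrier_vec n \<Longrightarrow> r \<in> carrier_vec n \<Longrightarrow>
      y = (\<i> * complex_of_real c) \<cdot>\<^sub>v (A *\<^sub>v y) - complex_of_real b \<cdot>\<^sub>v y + r \<longleftrightarrow> y = G *\<^sub>v r"
proof -
  define B where "B = complex_of_real (1 + b) \<cdot>\<^sub>m 1\<^sub>m n + (- (\<i> * complex_of_real c)) \<cdot>\<^sub>m A"
  have B: "B \<in> carrier_mat n n" using A by (auto simp: B_def)
  have Bi: "(B *\<^sub>v y) $ i = complex_of_real (1 + b) * y $ i - \<i> * complex_of_real c * (A *\<^sub>v y) $ i"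
    if "y \<in> carrier_vec n" "i < n" for y i
    using smult_one_plus_smult_mult_vec_nth[OF A that] by (simp add: B_def)
  have eqB: "y = (\<i> * complex_of_real c) \<cdot>\<^sub>v (A *\<^sub>v y) - complex_of_real b \<cdot>\<^sub>v y + r \<longleftrightarrow> B *\<^sub>v y = r"
    if y: "y \<in> carrier_vec n" and r: "r \<in> carrier_vec n" for y r
  proof -
    have "y = (\<i> * complex_of_real c) \<cdot>\<^sub>v (A *\<^sub>v y) - complex_of_real b \<cdot>\<^sub>v y + r \<longleftrightarrow>
      (\<forall>i<n. y $ i = \<i> * complex_of_real c * (A *\<^sub>v y) $ i - complex_of_real b * y $ i + r $ i)"
      using y r A by (auto simp: vec_eq_iff)
    also have "\<dots> \<longleftrightarrow> (\<forall>i<n. (B *\<^sub>v y) $ i = r $ i)"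
      using Bi[OF y] by (auto simp: algebra_simps)
    also have "\<dots> \<longleftrightarrow> B *\<^sub>v y = r"
      using y r B by (auto simp: vec_eq_iff)
    finally show ?thesis .
  qed
  have "v = 0\<^sub>v n" if v: "v \<in> carrier_vec n" and Bv: "B *\<^sub>v v = 0\<^sub>v n" for v
  proof -
    have "(1 + b)\<^sup>2 * sq_norm v \<le> sq_norm (0\<^sub>v n)"
      using crank_nicolson_resolvent_bound[OF A herm v, of "0\<^sub>v n" c b] eqB[OF v, of "0\<^sub>v n"] Bv by simp
    then have "sq_norm v \<le> 0"
      using b by (simp add: sq_norm_def mult_le_0_iff)
    then show ?thesis
      using sq_norm_ge_0[of v] sq_norm_eq_0[OF v] by linarith
  qed
  then have "Determinant.det B \<noteq> 0"
    using det_0_iff_vec_prod_zero[OF B] by auto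
  \<comment> \<open>Membership in the units of the matrix ring unfolds to a two-sided inverse;
    \<open>()\<close> merely fills the extension slot of the ring record.\<close>
  from det_non_zero_imp_unit[OF B this, of "()"]
  obtain G where G: "G \<in> carrier_mat n n" "G * B = 1\<^sub>m n" "B * G = 1\<^sub>m n"
    by (auto simp: Units_def ring_mat_def)
  have "B *\<^sub>v y = r \<longleftrightarrow> y = G *\<^sub>v r" if y: "y \<in> carrier_vec n" and r: "r \<in> carrier_vec n" for y r
  proof
    assume "B *\<^sub>v y = r"
    then have "G *\<^sub>v r = (G * B) *\<^sub>v y" using assoc_mult_mat_vec[OF G(1) B y] by simp
    then show "y = G *\<^sub>v r" using G(2) y by simp
  next
    assume "y = G *\<^sub>v r"
    then have "B *\<^sub>v y = (B * G) *\<^sub>v r" using assoc_mult_mat_vec[OF B G(1) r] by simp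
    then show "B *\<^sub>v y = r" using G(3) r by simp
  qed
  then show ?thesis by (intro that[OF G(1)]) (simp only: eqB)
qed

section \<open>The exponential of a diagonal matrix\<close>

lemma pow_mat_mat_diag: "mat_diag n g ^\<^sub>m m = mat_diag n (\<lambda>i. g i ^ m)"
proof (induction m)
  case 0
  then show ?case by (simp add: mat_diag_def[of n g])
qed (simp add: power_Suc2 del: power_Suc)

text \<open>Powers of a diagonal matrix are diagonal, so the defining series is the scalar
  exponential series on the diagonal and a series of zeros off it.\<close>

lemma mat_exp_mat_diag: "mat_exp n (mat_diag n g) = mat_diag n (\<lambda>i. exp (g i))"
proof -
  have "(\<Sum>m. g i ^ m / fact m) = exp (g i)" for i
    by (simp add: exp_def divide_inverse scaleR_conv_of_real mult.commute)
  then show ?thesis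
    unfolding mat_exp_def pow_mat_mat_diag
    by (intro eq_matI) (auto simp: mat_diag_def)
qed

lemma f_mat_eq_mat_diag:
  "f_mat J \<alpha> lam \<tau> u = mat_diag J (\<lambda>j. complex_of_real \<tau> *
     (complex_of_real (- \<alpha> / 2) + \<i> * complex_of_real lam * complex_of_real ((cmod (u $ j))\<^sup>2)))"
  by (intro eq_matI) (auto simp: f_mat_def F_mat_def mat_diag_def)

section \<open>Solution operators of the scheme\<close>

lemma laplacian_mat_carrier: "laplacian_mat J \<in> carrier_mat J J"
  by (simp add: laplacian_mat_def)

lemma laplacian_mat_hermitian:
  "i < J \<Longrightarrow> j < J \<Longrightarrow> laplacian_mat J $$ (j, i) = cnj (laplacian_mat J $$ (i, j))"
  by (auto simp: laplacian_mat_def)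

text \<open>\<open>K\<close> and \<open>N\<close> are chosen before \<open>lam\<close>,
  \<open>d\<close>, \<open>u\<close> and \<open>u'\<close>, so they are deterministic, as the
  probabilistic argument requires. They are the entries of \<open>G * D\<close> and
  \<open>G * S\<close>, given as plain functions so that later arguments deal with finite sums
  only.\<close>

lemma scheme_step_solution_operators:
  assumes \<tau>: "0 < \<tau>" and \<alpha>: "0 < \<alpha>"
  obtains K N :: "nat \<Rightarrow> nat \<Rightarrow> complex" where
    "\<And>lam d u u' j. u \<in> carrier_vec J \<Longrightarrow> u' \<in> carrier_vec J \<Longrightarrow> d \<in> carrier_vec P \<Longrightarrow>
       scheme_step J P \<tau> \<alpha> \<epsilon> lam \<eta> d u u' \<Longrightarrow> j < J \<Longrightarrow>
       u' $ j = (\<Sum>l<J. K j l * (exp (complex_of_real \<tau> * (complex_of_real (- \<alpha> / 2) +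
         \<i> * complex_of_real lam * complex_of_real ((cmod (u $ l))\<^sup>2))) * u $ l)) + (\<Sum>k<P. N j k * d $ k)"
    "\<And>w. (\<Sum>j<J. (cmod (\<Sum>l<J. K j l * w l))\<^sup>2) \<le> (\<Sum>l<J. (cmod (w l))\<^sup>2)"
    "\<And>k. k < P \<Longrightarrow> 0 \<le> \<eta> (Suc k) \<Longrightarrow>
       (1 + \<alpha> * \<tau> / 4)\<^sup>2 * (\<Sum>j<J. (cmod (N j k))\<^sup>2) \<le> 2 * \<epsilon>\<^sup>2 * \<eta> (Suc k) * real J"
proof -
  define c where "c = \<tau> / (2 * (mesh J)\<^sup>2)"
  define b where "b = \<alpha> * \<tau> / 4"
  define A where "A = laplacian_mat J"
  note A = laplacian_mat_carrier[of J, folded A_def] and herm = laplacian_mat_hermitian[where J = J, folded A_def]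
  have b: "0 \<le> b" using \<tau> \<alpha> by (simp add: b_def)
  obtain G where G: "G \<in> carrier_mat J J" and Geq: "\<And>y r. y \<in> carrier_vec J \<Longrightarrow> r \<in> carrier_vec J \<Longrightarrow>
      y = (\<i> * complex_of_real c) \<cdot>\<^sub>v (A *\<^sub>v y) - complex_of_real b \<cdot>\<^sub>v y + r \<longleftrightarrow> y = G *\<^sub>v r"
    using crank_nicolson_resolvent[OF A herm b] by blast
  define D where "D = complex_of_real (1 - b) \<cdot>\<^sub>m 1\<^sub>m J + (\<i> * complex_of_real c) \<cdot>\<^sub>m A"
  define S where "S = complex_of_real \<epsilon> \<cdot>\<^sub>m (sigma_mat J P * Lambda_mat P \<eta>)"
  have D: "D \<in> carrier_mat J J" using A by (simp add: D_def)
  have sL: "sigma_mat J P * Lambda_mat P \<eta> \<in> carrier_mat J P"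
    by (rule mult_carrier_mat[where n = P]) (simp_all add: sigma_mat_def Lambda_mat_def)
  have S: "S \<in> carrier_mat J P" using sL by (simp add: S_def)
  have Di: "(D *\<^sub>v w) $ i = complex_of_real (1 - b) * w $ i + \<i> * complex_of_real c * (A *\<^sub>v w) $ i"
    if "w \<in> carrier_vec J" "i < J" for w i
    unfolding D_def using smult_one_plus_smult_mult_vec_nth[OF A that] .
  have Aadd: "(A *\<^sub>v (y + w)) = A *\<^sub>v y + A *\<^sub>v w" if "y \<in> carrier_vec J" "w \<in> carrier_vec J" for y w
    using mult_add_distrib_mat_vec[OF A that] .
  \<comment> \<open>Moving the terms with \<open>y\<close> to the left turns the Crank-Nicolson step
    into the resolvent equation with right-hand side \<open>D *\<^sub>v w + x\<close>.\<close>
  have step_iff: "y - w = (\<i> * complex_of_real c) \<cdot>\<^sub>v (A *\<^sub>v (y + w)) - complex_of_real b \<cdot>\<^sub>v (y + w) + x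
      \<longleftrightarrow> y = G *\<^sub>v (D *\<^sub>v w + x)"
    if v: "y \<in> carrier_vec J" "w \<in> carrier_vec J" "x \<in> carrier_vec J" for y w x
  proof -
    have "y - w = (\<i> * complex_of_real c) \<cdot>\<^sub>v (A *\<^sub>v (y + w)) - complex_of_real b \<cdot>\<^sub>v (y + w) + x \<longleftrightarrow>
      y = (\<i> * complex_of_real c) \<cdot>\<^sub>v (A *\<^sub>v y) - complex_of_real b \<cdot>\<^sub>v y + (D *\<^sub>v w + x)"
      unfolding Aadd[OF v(1,2)] vec_eq_iff using v A D
      by (simp add: Di[OF v(2)] algebra_simps del: index_mult_mat_vec)
    then show ?thesis using Geq[OF v(1)] v D by simp
  qed
  define K where "K j l = (G * D) $$ (j, l)" for j l
  define N where "N j k = (G * S) $$ (j, k)" for j k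
  have GD: "G * D \<in> carrier_mat J J" and GS: "G * S \<in> carrier_mat J P"
    using G D S by auto
  show ?thesis
  proof (rule that[of K N])
    fix lam d u u' j
    assume u: "u \<in> carrier_vec J" "u' \<in> carrier_vec J" and d: "d \<in> carrier_vec P"
      and step: "scheme_step J P \<tau> \<alpha> \<epsilon> lam \<eta> d u u'" and j: "j < J"
    define g where "g l = exp (complex_of_real \<tau> * (complex_of_real (- \<alpha> / 2) +
         \<i> * complex_of_real lam * complex_of_real ((cmod (u $ l))\<^sup>2)))" for l
    define w where "w = mat_exp J (f_mat J \<alpha> lam \<tau> u) *\<^sub>v u"
    have w': "w = mat_diag J g *\<^sub>v u"
      unfolding w_def f_mat_eq_mat_diag mat_exp_mat_diag g_def ..
    have w: "w \<in> carrier_vec J" unfolding w' using mat_diag_dim u(1) by (rule mult_mat_vec_carrier)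
    have wl: "w $ l = g l * u $ l" if "l < J" for l
    proof -
      have "w $ l = (\<Sum>k<J. if l = k then g k * u $ k else 0)"
        unfolding w' mult_mat_vec_nth[OF mat_diag_dim u(1) that]
        using that by (intro sum.cong) (auto simp: mat_diag_def)
      then show ?thesis using that by simp
    qed
    have Sd: "S *\<^sub>v d = complex_of_real \<epsilon> \<cdot>\<^sub>v ((sigma_mat J P * Lambda_mat P \<eta>) *\<^sub>v d)"
      unfolding S_def by (rule smult_mat_mult_mat_vec[OF sL d])
    have "u' - w = (\<i> * complex_of_real c) \<cdot>\<^sub>v (A *\<^sub>v (u' + w)) - complex_of_real b \<cdot>\<^sub>v (u' + w) + S *\<^sub>v d"
      using step unfolding scheme_step_def Let_def w_def[symmetric] c_def b_def A_def Sd .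
    then have "u' = G *\<^sub>v (D *\<^sub>v w + S *\<^sub>v d)"
      using step_iff[OF u(2) w] S d by simp
    also have "\<dots> = (G * D) *\<^sub>v w + (G * S) *\<^sub>v d"
      using G D S w d by (simp add: mult_add_distrib_mat_vec[of G J J] assoc_mult_mat_vec[of G J J])
    finally have "u' $ j = ((G * D) *\<^sub>v w) $ j + ((G * S) *\<^sub>v d) $ j"
      using j G D S w d by simp
    then show "u' $ j = (\<Sum>l<J. K j l * (g l * u $ l)) + (\<Sum>k<P. N j k * d $ k)"
      unfolding mult_mat_vec_nth[OF GD w j] mult_mat_vec_nth[OF GS d j] K_def N_def using wl by simp
  next
    fix w :: "nat \<Rightarrow> complex"
    define y where "y = (G * D) *\<^sub>v Matrix.vec J w"
    have y: "y \<in> carrier_vec J" using GD by (simp add: y_def)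
    \<comment> \<open>With zero noise, \<open>step_iff\<close> read backwards shows that
      \<open>y\<close> is the noiseless step from \<open>w\<close>, to which the contraction
      estimate applies.\<close>
    have "y = G *\<^sub>v (D *\<^sub>v Matrix.vec J w + 0\<^sub>v J)"
      using G D by (simp add: y_def assoc_mult_mat_vec[of G J J])
    then have "y - Matrix.vec J w = (\<i> * complex_of_real c) \<cdot>\<^sub>v (A *\<^sub>v (y + Matrix.vec J w))
        - complex_of_real b \<cdot>\<^sub>v (y + Matrix.vec J w)"
      using step_iff[OF y, of "Matrix.vec J w" "0\<^sub>v J"] y A by simp
    then have "sq_norm y \<le> sq_norm (Matrix.vec J w)"
      using crank_nicolson_contraction[OF A herm y _ b] by simp
    moreover have "y $ j = (\<Sum>l<J. K j l * w l)" if "j < J" for j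
      using mult_mat_vec_nth[OF GD _ that, of "Matrix.vec J w"] by (simp add: y_def K_def)
    ultimately show "(\<Sum>j<J. (cmod (\<Sum>l<J. K j l * w l))\<^sup>2) \<le> (\<Sum>l<J. (cmod (w l))\<^sup>2)"
      using y by (simp add: sq_norm_def)
  next
    fix k assume k: "k < P" and \<eta>: "0 \<le> \<eta> (Suc k)"
    have cS: "col S k \<in> carrier_vec J" and cN: "col (G * S) k \<in> carrier_vec J" using S GS k by auto
    have "col (G * S) k = G *\<^sub>v col S k" using col_mult2[OF G S k] .
    \<comment> \<open>A column of \<open>G * S\<close> solves the resolvent equation whose
      right-hand side is the same column of \<open>S\<close>, so the noise gains the resolvent
      factor.\<close>
    then have "(1 + b)\<^sup>2 * sq_norm (col (G * S) k) \<le> sq_norm (col S k)"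
      using crank_nicolson_resolvent_bound[OF A herm cN cS] Geq[OF cN cS] by blast
    moreover have "sq_norm (col (G * S) k) = (\<Sum>j<J. (cmod (N j k))\<^sup>2)"
      unfolding sq_norm_def carrier_vecD[OF cN] N_def
    proof (intro sum.cong refl)
      fix j assume "j \<in> {..<J}"
      then have "col (G * S) k $ j = (G * S) $$ (j, k)"
        using carrier_matD[OF GS] k by (intro index_col) (simp_all only: lessThan_iff)
      then show "(cmod (col (G * S) k $ j))\<^sup>2 = (cmod ((G * S) $$ (j, k)))\<^sup>2" by (simp only:)
    qed
    moreover have "sq_norm (col S k) \<le> (\<Sum>j<J. 2 * \<epsilon>\<^sup>2 * \<eta> (Suc k))"
    proof -
      have "(cmod (col S k $ j))\<^sup>2 \<le> 2 * \<epsilon>\<^sup>2 * \<eta> (Suc k)" if j: "j < J" for j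
      proof -
        have "col S k $ j = complex_of_real \<epsilon> * (sine_basis (Suc k) (grid_point J (Suc j)) * complex_of_real (sqrt (\<eta> (Suc k))))"
          using sL j k unfolding S_def Lambda_mat_def
          by (subst mat_diag_mult_right[of _ J]) (auto simp: sigma_mat_def)
        then have "(cmod (col S k $ j))\<^sup>2 = \<epsilon>\<^sup>2 * ((cmod (sine_basis (Suc k) (grid_point J (Suc j))))\<^sup>2 * \<eta> (Suc k))"
          using \<eta> by (simp add: norm_mult power_mult_distrib)
        also have "\<dots> \<le> \<epsilon>\<^sup>2 * (2 * \<eta> (Suc k))"
          using \<eta> by (intro mult_left_mono mult_right_mono cmod_sine_basis_sq_le) auto
        finally show ?thesis by simp
      qed
      then show ?thesis unfolding sq_norm_def carrier_vecD[OF cS] by (intro sum_mono) simp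
    qed
    ultimately show "(1 + \<alpha> * \<tau> / 4)\<^sup>2 * (\<Sum>j<J. (cmod (N j k))\<^sup>2) \<le> 2 * \<epsilon>\<^sup>2 * \<eta> (Suc k) * real J"
      by (simp add: b_def mult_ac)
  qed
qed

section \<open>The energy recursion\<close>

text \<open>Both \<open>1 - exp (- x) \<ge> x / (1 + x)\<close> and
  \<open>1 + x \<le> 2 * (1 + x / 4)\<^sup>2\<close> hold. With
  \<open>x = \<alpha> * \<tau>\<close>, the noise added in one step is absorbed by the damping of
  that step for every size of \<tau>.\<close>

lemma damping_inequality:
  fixes x :: real
  assumes "0 < x"
  shows "x / (1 + x / 4)\<^sup>2 \<le> 2 * (1 - exp (- x))"
proof -
  have "exp (- x) \<le> 1 / (1 + x)"
    using exp_ge_add_one_self[of x] assms by (simp add: exp_minus field_simps)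
  moreover have "1 + x \<le> 2 * (1 + x / 4)\<^sup>2"
    by (simp add: power2_eq_square field_simps)
  then have "x * (1 + x) \<le> x * (2 * (1 + x / 4)\<^sup>2)"
    using assms by (intro mult_left_mono) auto
  then have "x / (1 + x / 4)\<^sup>2 \<le> 2 * x / (1 + x)"
    using assms by (simp add: divide_simps mult_ac)
  moreover have "2 * x / (1 + x) = 2 * (1 - 1 / (1 + x))"
    using assms by (simp add: field_simps)
  ultimately show ?thesis by (smt (verit))
qed

text \<open>The scheme holds only almost surely, so \<open>\<Psi> n\<close> itself need not be
  adapted. The functions \<open>\<phi> j\<close> are adapted versions of its components, and the
  step produces such versions at the next time along with the energy bound.\<close>

lemma scheme_energy_step:
  fixes B :: "nat \<times> nat \<Rightarrow> real \<Rightarrow> 'w \<Rightarrow> real"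
  assumes fps: "filtered_prob_space M F" and B: "independent_brownian_motions M F ({1..P} \<times> {1, 2}) B"
    and \<tau>: "0 < \<tau>" and \<alpha>: "0 < \<alpha>"
    and \<eta>: "\<And>k. 0 \<le> \<eta> (Suc k)" "summable (\<lambda>k. \<eta> (Suc k))"
    and \<Psi>: "\<And>\<omega>. \<omega> \<in> space M \<Longrightarrow> \<Psi> n \<omega> \<in> carrier_vec J" "\<And>\<omega>. \<omega> \<in> space M \<Longrightarrow> \<Psi> (Suc n) \<omega> \<in> carrier_vec J"
    and step: "AE \<omega> in M. scheme_step J P \<tau> \<alpha> \<epsilon> lam \<eta> (noise_increment P \<tau> B n \<omega>) (\<Psi> n \<omega>) (\<Psi> (Suc n) \<omega>)"
    and \<phi>: "\<And>j. j < J \<Longrightarrow> \<phi> j \<in> borel_measurable (F (real n * \<tau>))"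
      "\<And>j. j < J \<Longrightarrow> integrable M (\<lambda>\<omega>. (cmod (\<phi> j \<omega>))\<^sup>2)"
      "AE \<omega> in M. \<forall>j<J. \<Psi> n \<omega> $ j = \<phi> j \<omega>"
  obtains \<phi>' where "\<And>j. j < J \<Longrightarrow> \<phi>' j \<in> borel_measurable (F (real (Suc n) * \<tau>))"
      "\<And>j. j < J \<Longrightarrow> integrable M (\<lambda>\<omega>. (cmod (\<phi>' j \<omega>))\<^sup>2)"
      "AE \<omega> in M. \<forall>j<J. \<Psi> (Suc n) \<omega> $ j = \<phi>' j \<omega>"
      "mesh J * (\<Sum>j<J. LINT \<omega>|M. (cmod (\<phi>' j \<omega>))\<^sup>2)
        \<le> exp (- \<alpha> * \<tau>) * (mesh J * (\<Sum>j<J. LINT \<omega>|M. (cmod (\<phi> j \<omega>))\<^sup>2))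
          + (1 - exp (- \<alpha> * \<tau>)) * (8 * \<epsilon>\<^sup>2 / \<alpha> * (\<Sum>k. \<eta> (Suc k)))"
proof -
  interpret prob_space M using fps by (simp add: filtered_prob_space_def)
  define s where "s = real n * \<tau>"
  define t where "t = real (Suc n) * \<tau>"
  have st: "0 \<le> s" "s < t" and ts: "t - s = \<tau>" using \<tau> by (auto simp: s_def t_def algebra_simps)
  have sub: "subalgebra M (F s)" using fps st by (auto simp: filtered_prob_space_def)
  obtain K N where KN:
    "\<And>lam d u u' j. u \<in> carrier_vec J \<Longrightarrow> u' \<in> carrier_vec J \<Longrightarrow> d \<in> carrier_vec P \<Longrightarrow>
       scheme_step J P \<tau> \<alpha> \<epsilon> lam \<eta> d u u' \<Longrightarrow> j < J \<Longrightarrow>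
       u' $ j = (\<Sum>l<J. K j l * (exp (complex_of_real \<tau> * (complex_of_real (- \<alpha> / 2) +
         \<i> * complex_of_real lam * complex_of_real ((cmod (u $ l))\<^sup>2))) * u $ l)) + (\<Sum>k<P. N j k * d $ k)"
    "\<And>w. (\<Sum>j<J. (cmod (\<Sum>l<J. K j l * w l))\<^sup>2) \<le> (\<Sum>l<J. (cmod (w l))\<^sup>2)"
    "\<And>k. k < P \<Longrightarrow> 0 \<le> \<eta> (Suc k) \<Longrightarrow>
       (1 + \<alpha> * \<tau> / 4)\<^sup>2 * (\<Sum>j<J. (cmod (N j k))\<^sup>2) \<le> 2 * \<epsilon>\<^sup>2 * \<eta> (Suc k) * real J"
    by (rule scheme_step_solution_operators[OF \<tau> \<alpha>, of J P \<epsilon> \<eta>]) (rule that)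
  define W where "W l \<omega> = exp (complex_of_real \<tau> * (complex_of_real (- \<alpha> / 2) +
         \<i> * complex_of_real lam * complex_of_real ((cmod (\<phi> l \<omega>))\<^sup>2))) * \<phi> l \<omega>" for l \<omega>
  define Y where "Y j \<omega> = (\<Sum>l<J. K j l * W l \<omega>)" for j \<omega>
  \<comment> \<open>The solved step is taken as a definition at every \<omega>, built from adapted
    functions: \<open>Y\<close> is known at time \<open>s\<close>, and the remaining sum involves
    only increments after \<open>s\<close>.\<close>
  define \<phi>' where "\<phi>' j = (\<lambda>\<omega>. Y j \<omega> + (\<Sum>k<P. N j k *
      Complex (B (Suc k, 1) t \<omega> - B (Suc k, 1) s \<omega>) (B (Suc k, 2) t \<omega> - B (Suc k, 2) s \<omega>)))" for j
  \<comment> \<open>The nonlinear part of the exponent is purely imaginary, so it only rotates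
    \<open>\<phi> l\<close> and leaves a deterministic damping factor.\<close>
  have W: "(cmod (W l \<omega>))\<^sup>2 = exp (- \<alpha> * \<tau>) * (cmod (\<phi> l \<omega>))\<^sup>2" for l \<omega>
    by (simp add: W_def norm_mult power_mult_distrib exp_double[symmetric] mult_ac)
  have YW: "(\<Sum>j<J. (cmod (Y j \<omega>))\<^sup>2) \<le> exp (- \<alpha> * \<tau>) * (\<Sum>l<J. (cmod (\<phi> l \<omega>))\<^sup>2)" for \<omega>
    using KN(2)[of "\<lambda>l. W l \<omega>"] by (simp only: Y_def W sum_distrib_left)
  have Wm: "W l \<in> borel_measurable (F s)" if "l < J" for l
    unfolding W_def using \<phi>(1)[OF that, folded s_def] by measurable
  have Ym: "Y j \<in> borel_measurable (F s)" for j
    unfolding Y_def using Wm by (auto intro!: borel_measurable_sum borel_measurable_times)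
  have int_sum: "integrable M (\<lambda>\<omega>. exp (- \<alpha> * \<tau>) * (\<Sum>l<J. (cmod (\<phi> l \<omega>))\<^sup>2))"
    using \<phi>(2) by (intro integrable_mult_right integrable_sum) auto
  \<comment> \<open>The contraction controls only the sum over all components, which dominates each
    single one.\<close>
  have Yi: "integrable M (\<lambda>\<omega>. (cmod (Y j \<omega>))\<^sup>2)" if j: "j < J" for j
  proof (rule Bochner_Integration.integrable_bound[OF int_sum])
    show "(\<lambda>\<omega>. (cmod (Y j \<omega>))\<^sup>2) \<in> borel_measurable M"
      using measurable_from_subalg[OF sub Ym] by measurable
    have "(cmod (Y j \<omega>))\<^sup>2 \<le> exp (- \<alpha> * \<tau>) * (\<Sum>l<J. (cmod (\<phi> l \<omega>))\<^sup>2)" for \<omega>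
      using member_le_sum[of j "{..<J}" "\<lambda>j. (cmod (Y j \<omega>))\<^sup>2"] j YW[of \<omega>] by simp
    then show "AE \<omega> in M. norm ((cmod (Y j \<omega>))\<^sup>2) \<le> norm (exp (- \<alpha> * \<tau>) * (\<Sum>l<J. (cmod (\<phi> l \<omega>))\<^sup>2))"
      by (intro AE_I2) (simp add: order_trans[OF _ abs_ge_self])
  qed
  have noise: "\<phi>' j \<in> borel_measurable (F t)"
    "has_bochner_integral M (\<lambda>\<omega>. (cmod (\<phi>' j \<omega>))\<^sup>2)
       ((LINT \<omega>|M. (cmod (Y j \<omega>))\<^sup>2) + 2 * \<tau> * (\<Sum>k<P. (cmod (N j k))\<^sup>2))" if "j < J" for j
    using additive_noise_second_moment[OF fps B st Ym Yi[OF that], where a = "N j"]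
    by (simp_all only: \<phi>'_def ts)
  have q: "0 < exp (- \<alpha> * \<tau>)" by simp
  show ?thesis
  proof (rule that[of \<phi>'])
    show "\<phi>' j \<in> borel_measurable (F (real (Suc n) * \<tau>))" if "j < J" for j
      using noise(1)[OF that] by (simp only: t_def)
    show "integrable M (\<lambda>\<omega>. (cmod (\<phi>' j \<omega>))\<^sup>2)" if "j < J" for j
      using noise(2)[OF that] by (rule integrable.intros)
    show "AE \<omega> in M. \<forall>j<J. \<Psi> (Suc n) \<omega> $ j = \<phi>' j \<omega>"
      using step \<phi>(3) AE_space
    proof eventually_elim
      fix \<omega> assume st: "scheme_step J P \<tau> \<alpha> \<epsilon> lam \<eta> (noise_increment P \<tau> B n \<omega>) (\<Psi> n \<omega>) (\<Psi> (Suc n) \<omega>)"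
        and eq: "\<forall>j<J. \<Psi> n \<omega> $ j = \<phi> j \<omega>" and \<omega>: "\<omega> \<in> space M"
      have d: "noise_increment P \<tau> B n \<omega> \<in> carrier_vec P" by (simp add: noise_increment_def)
      have dk: "noise_increment P \<tau> B n \<omega> $ k = Complex (B (Suc k, 1) t \<omega> - B (Suc k, 1) s \<omega>) (B (Suc k, 2) t \<omega> - B (Suc k, 2) s \<omega>)"
        if "k < P" for k
        using that unfolding noise_increment_def s_def t_def by (simp add: complex_diff)
      show "\<forall>j<J. \<Psi> (Suc n) \<omega> $ j = \<phi>' j \<omega>"
      proof (intro allI impI)
        fix j assume j: "j < J"
        show "\<Psi> (Suc n) \<omega> $ j = \<phi>' j \<omega>"
          unfolding KN(1)[OF \<Psi>(1)[OF \<omega>] \<Psi>(2)[OF \<omega>] d st j] \<phi>'_def Y_def W_def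
          using eq dk by (intro arg_cong2[of _ _ _ _ "(+)"] sum.cong) auto
      qed
    qed
    define S where "S = (\<Sum>k. \<eta> (Suc k))"
    define b where "b = (1 + \<alpha> * \<tau> / 4)\<^sup>2"
    have b: "0 < b" unfolding b_def using \<alpha> \<tau> by (intro zero_less_power add_pos_pos divide_pos_pos mult_pos_pos) auto
    have mesh: "0 < mesh J" "mesh J * real J \<le> 1" by (auto simp: mesh_def field_simps)
    have S: "(\<Sum>k<P. \<eta> (Suc k)) \<le> S" "0 \<le> S"
      using \<eta> by (auto simp: S_def intro: sum_le_suminf suminf_nonneg)
    have "b * (\<Sum>j<J. \<Sum>k<P. (cmod (N j k))\<^sup>2) = (\<Sum>k<P. b * (\<Sum>j<J. (cmod (N j k))\<^sup>2))"
      by (subst sum.swap) (simp add: sum_distrib_left)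
    also have "\<dots> \<le> (\<Sum>k<P. 2 * \<epsilon>\<^sup>2 * \<eta> (Suc k) * real J)"
      using KN(3) \<eta>(1) by (intro sum_mono) (simp add: b_def)
    also have "\<dots> = 2 * \<epsilon>\<^sup>2 * real J * (\<Sum>k<P. \<eta> (Suc k))"
      by (simp add: sum_distrib_left mult_ac)
    also have "\<dots> \<le> 2 * \<epsilon>\<^sup>2 * real J * S"
      using S by (intro mult_left_mono) auto
    finally have "mesh J * (b * (\<Sum>j<J. \<Sum>k<P. (cmod (N j k))\<^sup>2)) \<le> mesh J * (2 * \<epsilon>\<^sup>2 * real J * S)"
      using mesh by (intro mult_left_mono) auto
    also have "\<dots> = 2 * \<epsilon>\<^sup>2 * S * (mesh J * real J)" by simp
    also have "\<dots> \<le> 2 * \<epsilon>\<^sup>2 * S * 1"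
      using mesh S by (intro mult_left_mono) auto
    finally have noise_sum: "mesh J * (\<Sum>j<J. \<Sum>k<P. (cmod (N j k))\<^sup>2) \<le> 2 * \<epsilon>\<^sup>2 * S / b"
      using b by (simp add: field_simps)
    \<comment> \<open>Writing \<tau> as \<open>(\<alpha> * \<tau>) / \<alpha>\<close> prepares
      \<open>damping_inequality\<close>; its factor 2 turns the 4 into the 8 of the final
      constant.\<close>
    have "2 * \<tau> * (2 * \<epsilon>\<^sup>2 * S / b) = 4 * \<epsilon>\<^sup>2 * S / \<alpha> * ((\<alpha> * \<tau>) / b)"
      using \<alpha> by (simp add: field_simps)
    also have "\<dots> \<le> 4 * \<epsilon>\<^sup>2 * S / \<alpha> * (2 * (1 - exp (- (\<alpha> * \<tau>))))"
      unfolding b_def using \<alpha> \<tau> S damping_inequality[of "\<alpha> * \<tau>"]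
      by (intro mult_left_mono divide_nonneg_pos mult_nonneg_nonneg) auto
    also have "\<dots> = (1 - exp (- \<alpha> * \<tau>)) * (8 * \<epsilon>\<^sup>2 / \<alpha> * S)"
      using \<alpha> by (simp add: field_simps)
    finally have r: "2 * \<tau> * (2 * \<epsilon>\<^sup>2 * S / b) \<le> (1 - exp (- \<alpha> * \<tau>)) * (8 * \<epsilon>\<^sup>2 / \<alpha> * S)" .
    have "(\<Sum>j<J. LINT \<omega>|M. (cmod (\<phi>' j \<omega>))\<^sup>2)
        = (\<Sum>j<J. (LINT \<omega>|M. (cmod (Y j \<omega>))\<^sup>2) + 2 * \<tau> * (\<Sum>k<P. (cmod (N j k))\<^sup>2))"
      using has_bochner_integral_integral_eq[OF noise(2)] by simp
    also have "\<dots> = (LINT \<omega>|M. (\<Sum>j<J. (cmod (Y j \<omega>))\<^sup>2)) + 2 * \<tau> * (\<Sum>j<J. \<Sum>k<P. (cmod (N j k))\<^sup>2)"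
      using Yi by (simp add: sum.distrib sum_distrib_left)
    \<comment> \<open>The sum over \<open>j\<close> is brought under the integral first, because
      \<open>YW\<close> bounds the whole sum pointwise.\<close>
    also have "(LINT \<omega>|M. (\<Sum>j<J. (cmod (Y j \<omega>))\<^sup>2)) \<le> (LINT \<omega>|M. exp (- \<alpha> * \<tau>) * (\<Sum>l<J. (cmod (\<phi> l \<omega>))\<^sup>2))"
      using Yi YW by (intro integral_mono int_sum) auto
    also have "\<dots> = exp (- \<alpha> * \<tau>) * (\<Sum>l<J. LINT \<omega>|M. (cmod (\<phi> l \<omega>))\<^sup>2)"
      using \<phi>(2) by simp
    finally have "mesh J * (\<Sum>j<J. LINT \<omega>|M. (cmod (\<phi>' j \<omega>))\<^sup>2) \<le>
      mesh J * (exp (- \<alpha> * \<tau>) * (\<Sum>l<J. LINT \<omega>|M. (cmod (\<phi> l \<omega>))\<^sup>2) + 2 * \<tau> * (\<Sum>j<J. \<Sum>k<P. (cmod (N j k))\<^sup>2))"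
      using mesh by (intro mult_left_mono) auto
    also have "\<dots> = exp (- \<alpha> * \<tau>) * (mesh J * (\<Sum>l<J. LINT \<omega>|M. (cmod (\<phi> l \<omega>))\<^sup>2))
        + 2 * \<tau> * (mesh J * (\<Sum>j<J. \<Sum>k<P. (cmod (N j k))\<^sup>2))"
      by (simp only: distrib_left mult_ac)
    also have "\<dots> \<le> exp (- \<alpha> * \<tau>) * (mesh J * (\<Sum>l<J. LINT \<omega>|M. (cmod (\<phi> l \<omega>))\<^sup>2))
        + 2 * \<tau> * (2 * \<epsilon>\<^sup>2 * S / b)"
      using noise_sum \<tau> by (intro add_left_mono mult_left_mono) auto
    finally show "mesh J * (\<Sum>j<J. LINT \<omega>|M. (cmod (\<phi>' j \<omega>))\<^sup>2)
        \<le> exp (- \<alpha> * \<tau>) * (mesh J * (\<Sum>j<J. LINT \<omega>|M. (cmod (\<phi> j \<omega>))\<^sup>2))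
          + (1 - exp (- \<alpha> * \<tau>)) * (8 * \<epsilon>\<^sup>2 / \<alpha> * (\<Sum>k. \<eta> (Suc k)))"
      using r by (simp only: S_def)
  qed
qed

section \<open>Iteration over the time steps\<close>

lemma grid_point_in_unit_interval: "j < J \<Longrightarrow> grid_point J (Suc j) \<in> {0<..<1}"
  by (simp add: grid_point_def mesh_def field_simps)

text \<open>The step estimate is iterated for adapted versions with finite energy. Nonnegative
  integrals also cover an infinite initial energy, for which the right-hand side is
  infinite.\<close>

lemma scheme_energy_bound:
  fixes B :: "nat \<times> nat \<Rightarrow> real \<Rightarrow> 'w \<Rightarrow> real"
  assumes fps: "filtered_prob_space M F" and B: "independent_brownian_motions M F ({1..P} \<times> {1, 2}) B"
    and \<tau>: "0 < \<tau>" and \<alpha>: "0 < \<alpha>"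
    and \<eta>: "\<And>k. 0 \<le> \<eta> (Suc k)" "summable (\<lambda>k. \<eta> (Suc k))"
    and \<psi>0: "(\<lambda>(\<omega>, x). \<psi>0 \<omega> x) \<in> borel_measurable (F 0 \<Otimes>\<^sub>M unit_measure)"
    and sol: "scheme_solution M J P \<tau> \<alpha> \<epsilon> lam \<eta> B \<psi>0 \<Psi>"
  shows "ennreal (mesh J) * (\<integral>\<^sup>+ \<omega>. ennreal (sq_norm (\<Psi> n \<omega>)) \<partial>M)
              \<le> ennreal (exp (- \<alpha> * (real n * \<tau>))) * (ennreal (mesh J) * (\<integral>\<^sup>+ \<omega>. ennreal (sq_norm (\<Psi> 0 \<omega>)) \<partial>M))
                 + ennreal (8 * \<epsilon>\<^sup>2 / \<alpha> * (\<Sum>k. \<eta> (Suc k)))"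
proof -
  interpret prob_space M using fps by (simp add: filtered_prob_space_def)
  define C where "C = 8 * \<epsilon>\<^sup>2 / \<alpha> * (\<Sum>k. \<eta> (Suc k))"
  define q where "q = exp (- \<alpha> * \<tau>)"
  have C: "0 \<le> C" unfolding C_def using \<alpha> \<eta> by (intro mult_nonneg_nonneg divide_nonneg_pos suminf_nonneg) auto
  have q: "0 < q" "q \<le> 1" using \<alpha> \<tau> by (auto simp: q_def mult_nonneg_nonneg)
  have mesh: "0 < mesh J" by (simp add: mesh_def)
  have sol1: "\<And>n \<omega>. \<omega> \<in> space M \<Longrightarrow> \<Psi> n \<omega> \<in> carrier_vec J"
    and sol2: "AE \<omega> in M. \<Psi> 0 \<omega> = Matrix.vec J (\<lambda>j. \<psi>0 \<omega> (grid_point J (Suc j)))"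
    and sol3: "\<And>n. AE \<omega> in M. scheme_step J P \<tau> \<alpha> \<epsilon> lam \<eta> (noise_increment P \<tau> B n \<omega>) (\<Psi> n \<omega>) (\<Psi> (Suc n) \<omega>)"
    using sol unfolding scheme_solution_def by blast+
  \<comment> \<open>Nonnegative integrals of almost everywhere equal functions agree without any
    measurability of \<open>\<Psi> n\<close>, so its energy can be computed from the adapted
    version.\<close>
  have nn: "(\<integral>\<^sup>+ \<omega>. ennreal (sq_norm (\<Psi> n \<omega>)) \<partial>M) = (\<integral>\<^sup>+ \<omega>. ennreal (\<Sum>j<J. (cmod (\<phi> j \<omega>))\<^sup>2) \<partial>M)"
    if "AE \<omega> in M. \<forall>j<J. \<Psi> n \<omega> $ j = \<phi> j \<omega>" for n \<phi>
  proof (rule nn_integral_cong_AE)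
    show "AE \<omega> in M. ennreal (sq_norm (\<Psi> n \<omega>)) = ennreal (\<Sum>j<J. (cmod (\<phi> j \<omega>))\<^sup>2)"
      using that AE_space by eventually_elim (simp add: sq_norm_def carrier_vecD[OF sol1])
  qed
  have nn_int: "(\<integral>\<^sup>+ \<omega>. ennreal (\<Sum>j<J. (cmod (\<phi> j \<omega>))\<^sup>2) \<partial>M) = ennreal (\<Sum>j<J. LINT \<omega>|M. (cmod (\<phi> j \<omega>))\<^sup>2)"
    if "\<And>j. j < J \<Longrightarrow> integrable M (\<lambda>\<omega>. (cmod (\<phi> j \<omega>))\<^sup>2)" for \<phi> :: "nat \<Rightarrow> 'w \<Rightarrow> complex"
    using that by (subst nn_integral_eq_integral) (auto simp: sum_nonneg)
  define \<phi>0 where "\<phi>0 j \<omega> = \<psi>0 \<omega> (grid_point J (Suc j))" for j \<omega>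
  have \<phi>0m: "\<phi>0 j \<in> borel_measurable (F 0)" if "j < J" for j
  proof -
    \<comment> \<open>The grid point lies in the open unit interval, so the section of the jointly
      measurable \<open>\<psi>0\<close> at it is measurable with respect to
      \<open>F 0\<close>.\<close>
    have "grid_point J (Suc j) \<in> space unit_measure"
      using grid_point_in_unit_interval[OF that] by (simp add: space_restrict_space)
    from measurable_compose[OF measurable_Pair2'[OF this] \<psi>0]
    show ?thesis by (simp add: \<phi>0_def[abs_def])
  qed
  have \<phi>0: "AE \<omega> in M. \<forall>j<J. \<Psi> 0 \<omega> $ j = \<phi>0 j \<omega>"
    using sol2 by eventually_elim (simp add: \<phi>0_def)
  have sub: "subalgebra M (F 0)" using fps by (auto simp: filtered_prob_space_def)
  show ?thesis
  proof (cases "(\<integral>\<^sup>+ \<omega>. ennreal (sq_norm (\<Psi> 0 \<omega>)) \<partial>M) = \<infinity>")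
    case True \<comment> \<open>possible: point values are not controlled by the \<open>L\<^sup>2\<close> norm of \<open>\<psi>\<^sub>0\<close>\<close>
    then show ?thesis using mesh by (simp add: ennreal_mult_top)
  next
    case False
    have \<phi>0i: "integrable M (\<lambda>\<omega>. (cmod (\<phi>0 j \<omega>))\<^sup>2)" if j: "j < J" for j
    proof (rule integrableI_bounded)
      show "(\<lambda>\<omega>. (cmod (\<phi>0 j \<omega>))\<^sup>2) \<in> borel_measurable M"
        using measurable_from_subalg[OF sub \<phi>0m[OF j]] by measurable
      have "(\<integral>\<^sup>+ \<omega>. ennreal (norm ((cmod (\<phi>0 j \<omega>))\<^sup>2)) \<partial>M) \<le> (\<integral>\<^sup>+ \<omega>. ennreal (\<Sum>j<J. (cmod (\<phi>0 j \<omega>))\<^sup>2) \<partial>M)"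
        using j by (intro nn_integral_mono ennreal_leI) (auto intro!: member_le_sum)
      also have "\<dots> < \<infinity>" using False nn[OF \<phi>0] by (simp add: less_top)
      finally show "(\<integral>\<^sup>+ \<omega>. ennreal (norm ((cmod (\<phi>0 j \<omega>))\<^sup>2)) \<partial>M) < \<infinity>" .
    qed
    define E0 where "E0 = mesh J * (\<Sum>j<J. LINT \<omega>|M. (cmod (\<phi>0 j \<omega>))\<^sup>2)"
    have E0: "0 \<le> E0" using mesh by (auto simp: E0_def intro!: mult_nonneg_nonneg sum_nonneg)
    \<comment> \<open>The induction carries the adapted version together with the bound, since the
      next step needs its measurability at time \<open>real n * \<tau>\<close> and its square
      integrability.\<close>
    have "\<exists>\<phi>. (\<forall>j<J. \<phi> j \<in> borel_measurable (F (real n * \<tau>)) \<and> integrable M (\<lambda>\<omega>. (cmod (\<phi> j \<omega>))\<^sup>2)) \<and>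
        (AE \<omega> in M. \<forall>j<J. \<Psi> n \<omega> $ j = \<phi> j \<omega>) \<and>
        mesh J * (\<Sum>j<J. LINT \<omega>|M. (cmod (\<phi> j \<omega>))\<^sup>2) \<le> q ^ n * E0 + C"
    proof (induction n)
      case 0
      show ?case using \<phi>0m \<phi>0i \<phi>0 C by (intro exI[of _ \<phi>0]) (simp add: E0_def)
    next
      case (Suc n)
      then obtain \<phi> where \<phi>: "\<And>j. j < J \<Longrightarrow> \<phi> j \<in> borel_measurable (F (real n * \<tau>))"
          "\<And>j. j < J \<Longrightarrow> integrable M (\<lambda>\<omega>. (cmod (\<phi> j \<omega>))\<^sup>2)"
          "AE \<omega> in M. \<forall>j<J. \<Psi> n \<omega> $ j = \<phi> j \<omega>"
        and IH: "mesh J * (\<Sum>j<J. LINT \<omega>|M. (cmod (\<phi> j \<omega>))\<^sup>2) \<le> q ^ n * E0 + C"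
        by blast
      obtain \<phi>' where \<phi>': "\<And>j. j < J \<Longrightarrow> \<phi>' j \<in> borel_measurable (F (real (Suc n) * \<tau>))"
          "\<And>j. j < J \<Longrightarrow> integrable M (\<lambda>\<omega>. (cmod (\<phi>' j \<omega>))\<^sup>2)"
          "AE \<omega> in M. \<forall>j<J. \<Psi> (Suc n) \<omega> $ j = \<phi>' j \<omega>"
          and le: "mesh J * (\<Sum>j<J. LINT \<omega>|M. (cmod (\<phi>' j \<omega>))\<^sup>2)
            \<le> q * (mesh J * (\<Sum>j<J. LINT \<omega>|M. (cmod (\<phi> j \<omega>))\<^sup>2)) + (1 - q) * C"
        using scheme_energy_step[where \<Psi> = \<Psi> and n = n and \<phi> = \<phi>, OF fps B \<tau> \<alpha> \<eta> sol1 sol1 sol3 \<phi>]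
        unfolding q_def C_def by blast
      note le
      also have "q * (mesh J * (\<Sum>j<J. LINT \<omega>|M. (cmod (\<phi> j \<omega>))\<^sup>2)) + (1 - q) * C \<le> q * (q ^ n * E0 + C) + (1 - q) * C"
        using IH q by (intro add_right_mono mult_left_mono) auto
      \<comment> \<open>\<open>C\<close> is the fixed point of
        \<open>x \<mapsto> q * x + (1 - q) * C\<close>, so it is reproduced exactly and does not
        grow with \<open>n\<close>.\<close>
      also have "\<dots> = q ^ Suc n * E0 + C" by (simp add: algebra_simps)
      finally show ?case using \<phi>' by blast
    qed
    then obtain \<phi> where \<phi>: "\<And>j. j < J \<Longrightarrow> integrable M (\<lambda>\<omega>. (cmod (\<phi> j \<omega>))\<^sup>2)"
          "AE \<omega> in M. \<forall>j<J. \<Psi> n \<omega> $ j = \<phi> j \<omega>"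
        and le: "mesh J * (\<Sum>j<J. LINT \<omega>|M. (cmod (\<phi> j \<omega>))\<^sup>2) \<le> q ^ n * E0 + C"
      by blast
    have qn: "q ^ n = exp (- \<alpha> * (real n * \<tau>))"
      by (simp add: q_def exp_of_nat_mult[symmetric] mult_ac)
    have "ennreal (mesh J) * (\<integral>\<^sup>+ \<omega>. ennreal (sq_norm (\<Psi> n \<omega>)) \<partial>M)
        = ennreal (mesh J * (\<Sum>j<J. LINT \<omega>|M. (cmod (\<phi> j \<omega>))\<^sup>2))"
      using mesh by (simp add: nn[OF \<phi>(2)] nn_int[OF \<phi>(1)] ennreal_mult sum_nonneg)
    also have "\<dots> \<le> ennreal (q ^ n * E0 + C)" using le by (rule ennreal_leI)
    also have "\<dots> = ennreal (q ^ n) * ennreal E0 + ennreal C"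
      using q E0 C by (simp add: ennreal_mult ennreal_plus)
    also have "ennreal E0 = ennreal (mesh J) * (\<integral>\<^sup>+ \<omega>. ennreal (sq_norm (\<Psi> 0 \<omega>)) \<partial>M)"
      using mesh by (simp add: E0_def nn[OF \<phi>0] nn_int[OF \<phi>0i] ennreal_mult sum_nonneg)
    finally show ?thesis unfolding qn C_def .
  qed
qed

theorem proposition3p2:
  fixes \<alpha> \<epsilon> Cstar :: real
    and Q :: "(real \<Rightarrow> complex) \<Rightarrow> (real \<Rightarrow> complex)"
    and \<eta> :: "nat \<Rightarrow> real"
  assumes "0 < \<alpha>" and "0 \<le> \<epsilon>" and "1 \<le> Cstar"
    and "positive_L2_operator Q"
    and "\<forall>k\<ge>1. 0 \<le> \<eta> k \<and>
           (AE x in unit_measure. Q (sine_basis k) x = complex_of_real (sqrt (\<eta> k)) * sine_basis k x)"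
    and "hilbert_schmidt_L2_Hdot2 Q"
  shows "\<exists>C\<ge>0. \<forall>(J::nat) (P::nat) (\<tau>::real) (lam::real) (M::'w measure) F B \<psi>0 \<Psi>.
           1 \<le> J \<longrightarrow> 1 \<le> P \<longrightarrow> real P \<le> Cstar * (real J + 1) \<longrightarrow>
           0 < \<tau> \<longrightarrow> lam \<in> {1, -1} \<longrightarrow>
           filtered_prob_space M F \<longrightarrow>
           independent_brownian_motions M F ({1..P} \<times> {1, 2}) B \<longrightarrow>
           (\<lambda>(\<omega>, x). \<psi>0 \<omega> x) \<in> borel_measurable (F 0 \<Otimes>\<^sub>M unit_measure) \<longrightarrow>
           (\<integral>\<^sup>+ \<omega>. (\<integral>\<^sup>+ x. ennreal ((cmod (\<psi>0 \<omega> x))\<^sup>2) \<partial>unit_measure) \<partial>M) < \<infinity> \<longrightarrow>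
           scheme_solution M J P \<tau> \<alpha> \<epsilon> lam \<eta> B \<psi>0 \<Psi> \<longrightarrow>
           (\<forall>n\<ge>1. ennreal (mesh J) * (\<integral>\<^sup>+ \<omega>. ennreal (sq_norm (\<Psi> n \<omega>)) \<partial>M)
              \<le> ennreal (exp (- \<alpha> * (real n * \<tau>))) * (ennreal (mesh J) * (\<integral>\<^sup>+ \<omega>. ennreal (sq_norm (\<Psi> 0 \<omega>)) \<partial>M))
                 + ennreal C)"
proof -
  \<comment> \<open>Bounding the sums over \<open>k < P\<close> by the full series makes the
    constant independent of the discretisation, so it can be fixed before \<open>J\<close>,
    \<open>P\<close>, \<tau> and the probability space.\<close>
  let ?C = "8 * \<epsilon>\<^sup>2 / \<alpha> * (\<Sum>k. \<eta> (Suc k))"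
  have \<eta>: "\<And>k. 0 \<le> \<eta> (Suc k)" using assms(5) by simp
  have sum: "summable (\<lambda>k. \<eta> (Suc k))"
    using summable_eigenvalues[OF assms(6)] assms(5) by blast
  have "0 \<le> ?C"
    using \<open>0 < \<alpha>\<close> \<eta> sum by (intro mult_nonneg_nonneg divide_nonneg_pos suminf_nonneg) auto
  then show ?thesis
    by (intro exI[of _ ?C] conjI allI impI scheme_energy_bound[OF _ _ _ \<open>0 < \<alpha>\<close> \<eta> sum])
qed

end
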